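(* Let $(S_n)$ be the elephant random walk with memory parameter $p\in[0,1]$ and first-step parameter $q\in[0,1]$, and let $V_n=4\sum_{k=1}^{n-1}(S_k/k)^2$. Under the null hypothesis $\mathcal{H}_0$: $p=3/4$, $$\frac{1}{(\log n)^2}V_n\longrightarrow4\Lambda\quad\text{in distribution as }n\to\infty,$$ where $\Lambda=\int_0^1B_t^2\,\mathrm{d}t$ is the integral of the squared standard Brownian motion $(B_t)$. Moreover, under the alternative hypothesis $\mathcal{H}_1$: $p>3/4$, and conditionally on $\{L^2>0\}$, where $L$ is the almost sure limit of $S_n/n^{2p-1}$, $$\lim_{n\to\infty}\frac{1}{(\log n)^2}V_n=+\infty\qquad\text{almost surely}.$$
   Context: Elephant random walk (ERW): fix $q\in[0,1]$ and $p\in[0,1]$. Set $S_0=0$. The first step $X_1$ equals $+1$ with probability $q$ and $-1$ with probability $1-q$. For each $n\ge 1$, an integer $k$ is chosen uniformly at random among $1,\dots,n$ (independently of the past), and $X_{n+1}=X_k$ with probability $p$, $X_{n+1}=-X_k$ with probability $1-p$. The position is $S_{n+1}=S_n+X_{n+1}$, so $S_n=X_1+\cdots+X_n$. Equivalently, with $\mathcal{F}_n=\sigma(X_1,\dots,X_n)$, $\mathbb{P}(X_{n+1}=1\mid\mathcal{F}_n)=\frac12\bigl(1+(2p-1)\frac{S_n}{n}\bigr)$ and $\mathbb{P}(X_{n+1}=-1\mid\mathcal{F}_n)=\frac12\bigl(1-(2p-1)\frac{S_n}{n}\bigr)$ for all $n\ge1$. Known fact used to define $L$: in the superdiffusive regime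 $3/4<p\le1$, $S_n/n^{2p-1}$ converges almost surely to a random variable $L$, which the paper recalls as non-degenerate. "Conditionally on $\{L^2>0\}$" means under the conditional probability given this event. *)

theory Defs
  imports "HOL-Probability.Probability"
begin

definition past_events :: "'a measure \<Rightarrow> (nat \<Rightarrow> 'a \<Rightarrow> real) \<Rightarrow> nat \<Rightarrow> 'a set set" where
  "past_events M X n =
     sigma_sets (space M) (\<Union>k\<in>{1..n}. {X k -` A \<inter> space M | A. A \<in> sets borel})"

text \<open>
  The steps are \<open>X 1, X 2, \<dots>\<close>; the value \<open>X 0\<close> is irrelevant.
  In the transition from time \<open>n\<close> to \<open>n + 1\<close>, the first component of \<open>J\<close> is the remembered time
  and the second one tells whether the remembered step is repeated or reversed.
\<close>
locale elephant_random_walk = prob_space M for M :: "'a measure" +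
  fixes p q :: real and X :: "nat \<Rightarrow> 'a \<Rightarrow> real"
  assumes p_range: "p \<in> {0..1}"
    and q_range: "q \<in> {0..1}"
    and step_measurable: "\<And>n. 1 \<le> n \<Longrightarrow> X n \<in> borel_measurable M"
    and first_step_plus: "prob {\<omega> \<in> space M. X 1 \<omega> = 1} = q"
    and first_step_minus: "prob {\<omega> \<in> space M. X 1 \<omega> = -1} = 1 - q"
    and next_step: "\<And>n. 1 \<le> n \<Longrightarrow>
      \<exists>J :: 'a \<Rightarrow> nat \<times> bool.
        J \<in> measurable M (count_space UNIV) \<and>
        distr M (count_space UNIV) J
          = measure_pmf (pair_pmf (pmf_of_set {1..n}) (bernoulli_pmf p)) \<and>
        indep_set (past_events M X n) {J -` A \<inter> space M | A. A \<in> UNIV} \<and>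
        (AE \<omega> in M. X (Suc n) \<omega>
          = (case J \<omega> of (k, repeat) \<Rightarrow> if repeat then X k \<omega> else - X k \<omega>))"

definition position :: "(nat \<Rightarrow> 'a \<Rightarrow> real) \<Rightarrow> nat \<Rightarrow> 'a \<Rightarrow> real" where
  "position X n \<omega> = (\<Sum>k=1..n. X k \<omega>)"

definition V_stat :: "(nat \<Rightarrow> 'a \<Rightarrow> real) \<Rightarrow> nat \<Rightarrow> 'a \<Rightarrow> real" where
  "V_stat X n \<omega> = 4 * (\<Sum>k=1..<n. (position X k \<omega> / real k)\<^sup>2)"

text \<open>
  Only times \<open>t \<ge> 0\<close> matter. All paths (not merely almost all) are continuous, so that path
  functionals such as the integral of the square are measurable without completing the space.
\<close>
locale standard_brownian_motion = prob_space N for N :: "'b measure" +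
  fixes B :: "real \<Rightarrow> 'b \<Rightarrow> real"
  assumes value_measurable: "\<And>t. 0 \<le> t \<Longrightarrow> B t \<in> borel_measurable N"
    and starts_at_zero: "\<And>\<omega>. \<omega> \<in> space N \<Longrightarrow> B 0 \<omega> = 0"
    and continuous_paths: "\<And>\<omega>. \<omega> \<in> space N \<Longrightarrow> continuous_on {0..} (\<lambda>t. B t \<omega>)"
    and gaussian_increments: "\<And>s t. 0 \<le> s \<Longrightarrow> s < t \<Longrightarrow>
      distributed N lborel (\<lambda>\<omega>. B t \<omega> - B s \<omega>) (normal_density 0 (sqrt (t - s)))"
    and independent_increments: "\<And>(n :: nat) (t :: nat \<Rightarrow> real).
      0 \<le> t 0 \<Longrightarrow> (\<And>i. i < n \<Longrightarrow> t i \<le> t (Suc i)) \<Longrightarrow>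
      indep_vars (\<lambda>_. borel) (\<lambda>i \<omega>. B (t (Suc i)) \<omega> - B (t i) \<omega>) {..<n}"

end

theory Submission
  imports Defs "HOL-Real_Asymp.Real_Asymp"
begin

text \<open>
  The critical case is proved by comparing Laplace transforms. For \<open>l > 0\<close> the Feynman--Kac function
  \<open>h(s, x) = cosh (l s)\<^sup>-\<^sup>1\<^sup>/\<^sup>2 exp (- x\<^sup>2 l tanh (l s) / 2)\<close> solves \<open>\<partial>\<^sub>s h = \<partial>\<^sub>x\<^sub>x h / 2 - l\<^sup>2 x\<^sup>2 h / 2\<close>. If the increments
  \<open>Z\<^sub>k\<^sub>+\<^sub>1 - Z\<^sub>k\<close> of a chain have, given the past, almost mean \<open>0\<close> and variance \<open>d\<^sub>k\<close>, then by Taylor expansion the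
  expectation of \<open>exp (- l\<^sup>2/2 \<Sum>\<^sub>j\<^sub><\<^sub>k d\<^sub>j Z\<^sub>j\<^sup>2) h(\<Sum>\<^sub>j\<^sub>\<ge>\<^sub>k d\<^sub>j, Z\<^sub>k)\<close> is almost independent of \<open>k\<close>. This applies to
  \<open>Z\<^sub>k = S\<^sub>k / \<surd>(k log n)\<close> with \<open>d\<^sub>k = 1 / (k log n)\<close>, where \<open>\<Sum> d\<^sub>k Z\<^sub>k\<^sup>2 = V\<^sub>n / (4 (log n)\<^sup>2)\<close>, and to Brownian motion
  at the times \<open>k/m\<close>, where \<open>\<Sum> d\<^sub>k Z\<^sub>k\<^sup>2\<close> is a Riemann sum of \<open>\<Lambda>\<close>. Both Laplace transforms therefore converge to
  \<open>cosh (l)\<^sup>-\<^sup>1\<^sup>/\<^sup>2\<close>, and pointwise convergence of Laplace transforms gives convergence in distribution.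

  In the superdiffusive case \<open>S\<^sub>k\<close> is of exact order \<open>k\<^sup>2\<^sup>p\<^sup>-\<^sup>1\<close> where \<open>L \<noteq> 0\<close>, so \<open>V\<^sub>n\<close> grows at least like \<open>n\<^sup>4\<^sup>p\<^sup>-\<^sup>3\<close>.
\<close>

text \<open>For p = 3/4 the walk divided by sqrt k has increments of conditional variance about 1/k,
  and these add up to about log n. Run by the clock log k / log n and divided by sqrt (log n), it
  should look like Brownian motion on [0, 1]. Since (S_k / k)^2 is 1/k times (S_k / sqrt k)^2, one
  factor log n in the normalisation of V_n comes from the clock and the other from the size of the
  squares. The errors of all steps add up, and their sum has to vanish. Two of them are unbounded at
  first sight: the time expansion of h has an error growing with x, and the error of the conditional
  variance grows with |S_k|. The Gaussian decay of h tames the first, the identity E S_k^2 = k H_k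
  at p = 3/4, with H_k the harmonic number, the second. Neither tightness nor a functional limit
  theorem enters, because the functional at hand is one whose Laplace transform has a closed
  Feynman-Kac form.\<close>

section \<open>Elementary Taylor estimates\<close>

lemma abs_le_one_plus_square: "\<bar>x::real\<bar> \<le> 1 + x\<^sup>2"
proof -
  have "0 \<le> (\<bar>x\<bar> - 1)\<^sup>2" by simp
  then show ?thesis  by (simp add: power2_eq_square algebra_simps)
qed

text \<open>With \<open>t\<close> a multiple of \<open>x\<^sup>2\<close>, this lets a Gaussian
  absorb a polynomial of degree 4 in \<open>x\<close>.\<close>

lemma one_plus_power2_le_exp:
  fixes t :: real
  assumes "0 \<le> t"
  shows "(1 + t)\<^sup>2 \<le> 2 * exp t"
proof -
  have "1 + t + t\<^sup>2 / 2 \<le> exp t"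
    using exp_lower_Taylor_quadratic[OF assms] .
  then show ?thesis by (simp add: power2_eq_square algebra_simps)
qed

text \<open>With \<open>w = y + t\<close> the third derivative is
  \<open>exp (- w\<^sup>2) * (12 * w - 8 * w ^ 3)\<close>, and
  \<open>12 * (1 + w\<^sup>2)\<^sup>2 \<le> 24 * exp (w\<^sup>2)\<close> bounds it by 24 on the
  whole line; the constant 4 is 24 / 3!. Uniformity in \<open>y\<close> matters because the
  expansion point will be a random position.\<close>

lemma gauss_taylor:
  fixes y z :: real
  shows "\<bar>exp (-(y + z)\<^sup>2) - exp (-y\<^sup>2) * (1 - 2 * y * z + (2 * y\<^sup>2 - 1) * z\<^sup>2)\<bar> \<le> 4 * \<bar>z\<bar> ^ 3"
proof -
  define D where "D m t = exp (-(y + t)\<^sup>2) * (if m = 0 then 1 else if m = 1 then - 2 * (y + t)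
     else if m = 2 then 4 * (y + t)\<^sup>2 - 2 else 12 * (y + t) - 8 * (y + t) ^ 3)" for m :: nat and t :: real
  have D: "(D m has_real_derivative D (Suc m) t) (at t)" if "m < 3" for m t
  proof -
    from that consider "m = 0" | "m = 1" | "m = 2" by linarith
    then show ?thesis
    proof cases
      case 1
      then show ?thesis unfolding D_def by (auto intro!: derivative_eq_intros simp: algebra_simps)
    next
      case 2
      then show ?thesis unfolding D_def
        by (auto intro!: derivative_eq_intros simp: algebra_simps power2_eq_square)
    next
      case 3
      then show ?thesis unfolding D_def
        by (auto intro!: derivative_eq_intros simp: algebra_simps power2_eq_square power3_eq_cube)
    qed
  qed
  have "\<exists>t. \<bar>t\<bar> \<le> \<bar>z\<bar> \<and> D 0 z = (\<Sum>m<3. D m 0 / fact m * z ^ m) + D 3 t / fact 3 * z ^ 3"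
    by (rule Maclaurin_bi_le) (use D in auto)
  then obtain t where t: "D 0 z = (\<Sum>m<3. D m 0 / fact m * z ^ m) + D 3 t / fact 3 * z ^ 3"
    by blast
  have "D 0 z = exp (-(y + z)\<^sup>2)" by (simp add: D_def)
  moreover have "(\<Sum>m<3. D m 0 / fact m * z ^ m) = exp (-y\<^sup>2) * (1 - 2 * y * z + (2 * y\<^sup>2 - 1) * z\<^sup>2)"
  proof -
    have "(\<Sum>m<3. D m 0 / fact m * z ^ m) = D 0 0 + D 1 0 * z + D 2 0 / 2 * z\<^sup>2"
    proof -
      have "{..<3} = {0, 1, 2 :: nat}" by auto
      then show ?thesis by simp
    qed
    also have "D 2 0 / 2 = exp (-y\<^sup>2) * (2 * y\<^sup>2 - 1)" by (simp add: D_def)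
    also have "D 1 0 = exp (-y\<^sup>2) * (- 2 * y)" by (simp add: D_def)
    also have "D 0 0 = exp (-y\<^sup>2)" by (simp add: D_def)
    also have "exp (-y\<^sup>2) + exp (-y\<^sup>2) * (- 2 * y) * z + exp (-y\<^sup>2) * (2 * y\<^sup>2 - 1) * z\<^sup>2
      = exp (-y\<^sup>2) * (1 - 2 * y * z + (2 * y\<^sup>2 - 1) * z\<^sup>2)"
      by (simp add: right_diff_distrib distrib_left mult.assoc)
    finally show ?thesis .
  qed
  moreover have "\<bar>D 3 t\<bar> \<le> 24"
  proof -
    define w where "w = y + t"
    have 1: "\<bar>12 * w - 8 * w ^ 3\<bar> \<le> 12 * \<bar>w\<bar> + 8 * (\<bar>w\<bar> * w\<^sup>2)"
      by (rule order_trans[OF abs_triangle_ineq4]) (simp add: abs_mult power3_eq_cube power2_eq_square)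
    have 2: "\<bar>w\<bar> * w\<^sup>2 \<le> (1 + w\<^sup>2) * w\<^sup>2"
      by (intro mult_right_mono abs_le_one_plus_square) auto
    have 3: "12 * \<bar>w\<bar> + 8 * (\<bar>w\<bar> * w\<^sup>2) \<le> 12 * (1 + w\<^sup>2)\<^sup>2"
    proof -
      have "(1 + w\<^sup>2)\<^sup>2 = 1 + 2 * w\<^sup>2 + w\<^sup>2 * w\<^sup>2" "(1 + w\<^sup>2) * w\<^sup>2 = w\<^sup>2 + w\<^sup>2 * w\<^sup>2"
        by (simp_all add: power2_eq_square algebra_simps)
      then show ?thesis
        using abs_le_one_plus_square[of w] 2 zero_le_power2[of w] zero_le_square[of "w\<^sup>2"] by linarith
    qed
    have "\<bar>12 * w - 8 * w ^ 3\<bar> \<le> 24 * exp (w\<^sup>2)"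
      using 1 3 one_plus_power2_le_exp[of "w\<^sup>2"] by simp
    then have "exp (- w\<^sup>2) * \<bar>12 * w - 8 * w ^ 3\<bar> \<le> exp (- w\<^sup>2) * (24 * exp (w\<^sup>2))"
      by (rule mult_left_mono) simp
    also have "\<dots> = 24" by (simp add: exp_minus)
    finally have "exp (- w\<^sup>2) * \<bar>12 * w - 8 * w ^ 3\<bar> \<le> 24" .
    then show ?thesis by (simp add: D_def abs_mult w_def)
  qed
  ultimately have "exp (-(y + z)\<^sup>2) - exp (-y\<^sup>2) * (1 - 2 * y * z + (2 * y\<^sup>2 - 1) * z\<^sup>2)
    = D 3 t / 6 * z ^ 3"
    using t by (simp add: fact_numeral)
  then have "\<bar>exp (-(y + z)\<^sup>2) - exp (-y\<^sup>2) * (1 - 2 * y * z + (2 * y\<^sup>2 - 1) * z\<^sup>2)\<bar>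
    = \<bar>D 3 t\<bar> / 6 * \<bar>z\<bar> ^ 3"
    by (simp only: abs_mult power_abs abs_divide abs_numeral)
  also have "\<dots> \<le> 24 / 6 * \<bar>z\<bar> ^ 3"
    using \<open>\<bar>D 3 t\<bar> \<le> 24\<close> by (intro mult_right_mono divide_right_mono) auto
  finally show ?thesis by simp
qed

lemma exp_minus_taylor:
  fixes u :: real
  assumes "0 \<le> u"
  shows "\<bar>exp (-u) - 1 + u\<bar> \<le> u\<^sup>2"
proof (cases "u \<le> 1")
  case True
  have "1 + (-u) \<le> exp (-u)" by (rule exp_ge_add_one_self)
  moreover have "exp (-u) \<le> 1 - u + u\<^sup>2"
  proof -
    \<comment> \<open>The product equals 1 + u^3.\<close>
    have "1 \<le> (1 - u + u\<^sup>2) * (1 + u)"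
      using assms by (simp add: power2_eq_square algebra_simps)
    also have "\<dots> \<le> (1 - u + u\<^sup>2) * exp u"
      using True exp_ge_add_one_self[of u] by (intro mult_left_mono) auto
    finally have "exp (-u) * 1 \<le> exp (-u) * ((1 - u + u\<^sup>2) * exp u)" by (intro mult_left_mono) auto
    also have "\<dots> = 1 - u + u\<^sup>2" by (simp add: exp_minus)
    finally show ?thesis by simp
  qed
  ultimately show ?thesis by auto
next
  case False
  have "exp (-u) \<le> 1" using assms by simp
  moreover have "u \<le> u\<^sup>2" using False by (simp add: power2_eq_square)
  moreover have "1 + (-u) \<le> exp (-u)" by (rule exp_ge_add_one_self)
  ultimately show ?thesis using False unfolding abs_le_iff by linarith
qed

subsection \<open>The Feynman--Kac function of quadratic killing\<close>

text \<open>
  Here \<open>kac l s x\<close> is the expectation of \<open>exp (- l\<^sup>2/2 * \<integral>\<^sub>0\<^sup>s (x + B\<^sub>u)\<^sup>2 du)\<close>. The Riccati equation \<open>a' = l\<^sup>2/2 - 2 a\<^sup>2\<close> for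
  \<open>a = kac_quad l\<close> together with \<open>(kac_log l)' = a\<close> is what makes it solve the backward equation.
\<close>

definition kac_quad :: "real \<Rightarrow> real \<Rightarrow> real" where
  "kac_quad l s = l * tanh (l * s) / 2"

definition kac_log :: "real \<Rightarrow> real \<Rightarrow> real" where
  "kac_log l s = ln (cosh (l * s)) / 2"

definition kac :: "real \<Rightarrow> real \<Rightarrow> real \<Rightarrow> real" where
  "kac l s x = exp (- kac_log l s - kac_quad l s * x\<^sup>2)"

lemma kac_quad_deriv: "(kac_quad l has_real_derivative (l\<^sup>2 / 2 - 2 * (kac_quad l s)\<^sup>2)) (at s)"
proof -
  have "(kac_quad l has_real_derivative l * ((1 - (tanh (l * s))\<^sup>2) * l) / 2) (at s)"
    unfolding kac_quad_def by (auto intro!: derivative_eq_intros)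
  also have "l * ((1 - (tanh (l * s))\<^sup>2) * l) / 2 = l\<^sup>2 / 2 - 2 * (kac_quad l s)\<^sup>2"
    by (simp add: kac_quad_def power2_eq_square algebra_simps diff_divide_distrib)
  finally show ?thesis .
qed

lemma kac_log_deriv: "(kac_log l has_real_derivative kac_quad l s) (at s)"
  unfolding kac_quad_def kac_log_def
  by (auto intro!: derivative_eq_intros simp: tanh_def field_simps)

lemma kac_quad_bounds:
  assumes "0 < l" "0 \<le> s"
  shows "0 \<le> kac_quad l s" "kac_quad l s \<le> l / 2"
  using assms tanh_real_lt_1[of "l * s"] by (auto simp: kac_quad_def)

lemma kac_quad_pos: "0 < l \<Longrightarrow> 0 < s \<Longrightarrow> 0 < kac_quad l s"
  by (auto simp: kac_quad_def)

lemma kac_quad_mono: "0 < l \<Longrightarrow> s \<le> t \<Longrightarrow> kac_quad l s \<le> kac_quad l t"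
  by (auto simp: kac_quad_def)

lemma taylor_order2:
  fixes f f' f'' :: "real \<Rightarrow> real"
  assumes "0 \<le> d" "\<And>t. s \<le> t \<Longrightarrow> (f has_real_derivative f' t) (at t)"
    "\<And>t. s \<le> t \<Longrightarrow> (f' has_real_derivative f'' t) (at t)"
    "\<And>t. s \<le> t \<Longrightarrow> \<bar>f'' t\<bar> \<le> K"
  shows "\<bar>f (s + d) - f s - d * f' s\<bar> \<le> K * d\<^sup>2"
proof (cases "d = 0")
  case False
  define D where "D m = (if m = 0 then f else if m = 1 then f' else f'')" for m :: nat
  have "\<exists>t. s < t \<and> t < s + d \<and> f (s + d) = (\<Sum>m<2. D m s / fact m * (s + d - s) ^ m) + D 2 t / fact 2 * (s + d - s) ^ 2"
  proof (rule Taylor_up[where a = s])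
    show "\<forall>m t. m < 2 \<and> s \<le> t \<and> t \<le> s + d \<longrightarrow> DERIV (D m) t :> D (Suc m) t"
      using assms(2,3) by (auto simp: D_def less_2_cases_iff)
  qed (use False assms in \<open>auto simp: D_def\<close>)
  then obtain t where t: "s < t" "f (s + d) = f s + f' s * d + f'' t / 2 * d\<^sup>2"
    by (auto simp: D_def eval_nat_numeral)
  have "\<bar>f'' t\<bar> / 2 * d\<^sup>2 \<le> K * d\<^sup>2"
    using assms(4)[of t] t by (intro mult_right_mono) auto
  then show ?thesis unfolding t(2) by (simp add: abs_mult mult.commute)
qed auto

text \<open>Differentiating the Riccati equation gives a'' = - 4 a a'. Since 0 \<le> a \<le> l/2 and
  |a'| \<le> l^2 at all later times, |a''| is at most 2 l^3, uniformly in \<open>s\<close>.\<close>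

lemma kac_quad_taylor:
  assumes "0 < l" "0 \<le> s" "0 \<le> d"
  shows "\<bar>kac_quad l (s + d) - kac_quad l s - d * (l\<^sup>2 / 2 - 2 * (kac_quad l s)\<^sup>2)\<bar> \<le> 2 * l ^ 3 * d\<^sup>2"
proof (rule taylor_order2[OF assms(3) kac_quad_deriv])
  fix t assume "s \<le> t"
  let ?a = "kac_quad l t"
  show "((\<lambda>s. l\<^sup>2 / 2 - 2 * (kac_quad l s)\<^sup>2) has_real_derivative (- 4 * ?a * (l\<^sup>2 / 2 - 2 * ?a\<^sup>2))) (at t)"
    by (auto intro!: derivative_eq_intros kac_quad_deriv)
  have a: "0 \<le> ?a" "?a \<le> l / 2" using kac_quad_bounds[of l t] assms \<open>s \<le> t\<close> by auto
  have a2: "?a\<^sup>2 \<le> l\<^sup>2 / 4" using power_mono[OF a(2,1), of 2] by (simp add: power_divide)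
  have "\<bar>l\<^sup>2 / 2 - 2 * ?a\<^sup>2\<bar> \<le> l\<^sup>2" using a2 zero_le_power2[of l] zero_le_power2[of ?a]
    by (intro abs_leI) linarith+
  then have "4 * ?a * \<bar>l\<^sup>2 / 2 - 2 * ?a\<^sup>2\<bar> \<le> 4 * (l / 2) * l\<^sup>2" using a assms
    by (intro mult_mono) auto
  then show "\<bar>- 4 * ?a * (l\<^sup>2 / 2 - 2 * ?a\<^sup>2)\<bar> \<le> 2 * l ^ 3"
    using a by (simp add: abs_mult power2_eq_square power3_eq_cube)
qed

lemma kac_log_taylor:
  assumes "0 < l" "0 \<le> s" "0 \<le> d"
  shows "\<bar>kac_log l (s + d) - kac_log l s - d * kac_quad l s\<bar> \<le> l\<^sup>2 * d\<^sup>2"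
proof (rule taylor_order2[OF assms(3) kac_log_deriv kac_quad_deriv])
  fix t assume "s \<le> t"
  let ?a = "kac_quad l t"
  have a: "0 \<le> ?a" "?a \<le> l / 2" using kac_quad_bounds[of l t] assms \<open>s \<le> t\<close> by auto
  have a2: "?a\<^sup>2 \<le> l\<^sup>2 / 4" using power_mono[OF a(2,1), of 2] by (simp add: power_divide)
  show "\<bar>l\<^sup>2 / 2 - 2 * ?a\<^sup>2\<bar> \<le> l\<^sup>2" using a2 zero_le_power2[of l] zero_le_power2[of ?a]
    by (intro abs_leI) linarith+
qed

lemma kac_log_mono:
  assumes "0 < l" "0 \<le> s" "s \<le> t"
  shows "kac_log l s \<le> kac_log l t"
proof (rule DERIV_nonneg_imp_nondecreasing[OF assms(3)])
  fix x assume "s \<le> x" "x \<le> t"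
  then show "\<exists>y. (kac_log l has_real_derivative y) (at x) \<and> 0 \<le> y"
    using kac_log_deriv kac_quad_bounds(1)[of l x] assms by (intro exI[of _ "kac_quad l x"]) auto
qed

text \<open>
  The \<open>x\<close>-derivative and half the second \<open>x\<close>-derivative of \<open>kac l s\<close>, both damped by the killing
  over a time step \<open>d\<close>: the coefficients of the increment and of its square in a one-step expansion.
\<close>

definition kac_drift :: "real \<Rightarrow> real \<Rightarrow> real \<Rightarrow> real \<Rightarrow> real" where
  "kac_drift l s d x = exp (- (l\<^sup>2 / 2 * d * x\<^sup>2)) * kac l s x * (- 2 * kac_quad l s * x)"

definition kac_curvature :: "real \<Rightarrow> real \<Rightarrow> real \<Rightarrow> real \<Rightarrow> real" where
  "kac_curvature l s d x = exp (- (l\<^sup>2 / 2 * d * x\<^sup>2)) * kac l s x * (2 * (kac_quad l s)\<^sup>2 * x\<^sup>2 - kac_quad l s)"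

lemma kac_log_nonneg: "0 \<le> kac_log l s"
  using cosh_real_ge_1[of "l * s"] by (auto simp: kac_log_def)

lemma kac_pos: "0 < kac l s x"
  by (simp add: kac_def)

lemma kac_le_1: "0 < l \<Longrightarrow> 0 \<le> s \<Longrightarrow> kac l s x \<le> 1"
  using kac_log_nonneg[of l s] mult_nonneg_nonneg[OF kac_quad_bounds(1)[of l s] zero_le_power2[of x]]
  unfolding kac_def exp_le_one_iff by linarith

text \<open>
  At \<open>s = 0\<close> the function \<open>kac l s\<close> is constant \<open>1\<close> and does not decay; staying at \<open>s \<ge> e > 0\<close> is what
  makes all error terms of the one-step expansion uniform in \<open>x\<close>.
\<close>

lemma kac_times_poly_bound:
  assumes "0 < l" "0 < e" "e \<le> s"
  shows "kac l s x * (1 + x\<^sup>2)\<^sup>2 \<le> 2 * (1 + 1 / kac_quad l e)\<^sup>2"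
proof -
  define \<alpha> where "\<alpha> = kac_quad l e"
  have \<alpha>: "0 < \<alpha>" "\<alpha> \<le> kac_quad l s"
    using assms kac_quad_pos[of l e] kac_quad_mono[of l e s] by (auto simp: \<alpha>_def)
  \<comment> \<open>Passing from \<open>x\<^sup>2\<close> to \<open>\<alpha> * x\<^sup>2\<close>
    brings the polynomial to the scale on which the Gaussian decays. The price is a factor that
    blows up as \<open>e\<close> tends to 0.\<close>
  have "1 + x\<^sup>2 \<le> (1 + 1 / \<alpha>) * (1 + \<alpha> * x\<^sup>2)"
    using \<alpha> by (simp add: field_simps)
  then have "(1 + x\<^sup>2)\<^sup>2 \<le> ((1 + 1 / \<alpha>) * (1 + \<alpha> * x\<^sup>2))\<^sup>2"
    by (intro power_mono) auto
  also have "\<dots> = (1 + 1 / \<alpha>)\<^sup>2 * (1 + \<alpha> * x\<^sup>2)\<^sup>2"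
    by (simp add: power_mult_distrib)
  also have "\<dots> \<le> (1 + 1 / \<alpha>)\<^sup>2 * (2 * exp (\<alpha> * x\<^sup>2))"
    using \<alpha> by (intro mult_left_mono one_plus_power2_le_exp) auto
  finally have 1: "(1 + x\<^sup>2)\<^sup>2 \<le> (1 + 1 / \<alpha>)\<^sup>2 * (2 * exp (\<alpha> * x\<^sup>2))" .
  have "kac l s x \<le> exp (- (\<alpha> * x\<^sup>2))"
    using \<alpha> kac_log_nonneg[of l s] mult_right_mono[of \<alpha> "kac_quad l s" "x\<^sup>2"]
    by (simp add: kac_def)
  then have "kac l s x * (1 + x\<^sup>2)\<^sup>2 \<le> exp (- (\<alpha> * x\<^sup>2)) * ((1 + 1 / \<alpha>)\<^sup>2 * (2 * exp (\<alpha> * x\<^sup>2)))"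
    using 1 kac_pos[of l s x] by (intro mult_mono) auto
  also have "\<dots> = 2 * (1 + 1 / \<alpha>)\<^sup>2"
    by (simp add: exp_minus)
  finally show ?thesis by (simp add: \<alpha>_def)
qed

text \<open>In the variable \<open>sqrt a * x\<close>, where \<open>a = kac_quad l s\<close>, the
  function is a constant at most 1 times the standard bell curve of \<open>gauss_taylor\<close>. The
  rescaling multiplies the cubic error by a^(3/2), and a \<le> l/2 makes the result independent of
  \<open>s\<close>.\<close>

lemma kac_space_taylor:
  assumes "0 < l" "0 \<le> s"
  shows "\<bar>kac l s (x + z) - kac l s x * (1 - 2 * kac_quad l s * x * z
     + (2 * (kac_quad l s)\<^sup>2 * x\<^sup>2 - kac_quad l s) * z\<^sup>2)\<bar> \<le> 4 * sqrt (l / 2) ^ 3 * \<bar>z\<bar> ^ 3"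
proof -
  define a where "a = kac_quad l s"
  have a: "0 \<le> a" "a \<le> l / 2" using kac_quad_bounds[OF assms] by (auto simp: a_def)
  define y w where "y = sqrt a * x" and "w = sqrt a * z"
  have sq: "sqrt a * sqrt a = a" using a by simp
  have yw: "(y + w)\<^sup>2 = a * (x + z)\<^sup>2" "y\<^sup>2 = a * x\<^sup>2" "w\<^sup>2 = a * z\<^sup>2" "y * w = a * x * z"
    using a sq unfolding y_def w_def distrib_left[symmetric]
    by (simp_all add: power_mult_distrib mult.assoc[symmetric] mult.left_commute[of _ "sqrt a"])
  have "kac l s (x + z) - kac l s x * (1 - 2 * a * x * z + (2 * a\<^sup>2 * x\<^sup>2 - a) * z\<^sup>2)
    = exp (- kac_log l s) * (exp (-(y + w)\<^sup>2) - exp (-y\<^sup>2) * (1 - 2 * y * w + (2 * y\<^sup>2 - 1) * w\<^sup>2))"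
  proof -
    have "kac l s (x + z) = exp (- kac_log l s) * exp (-(y + w)\<^sup>2)"
      "kac l s x = exp (- kac_log l s) * exp (-y\<^sup>2)"
      by (simp_all only: kac_def yw a_def exp_add[symmetric] add_uminus_conv_diff)
    moreover have "1 - 2 * a * x * z + (2 * a\<^sup>2 * x\<^sup>2 - a) * z\<^sup>2 = 1 - 2 * y * w + (2 * y\<^sup>2 - 1) * w\<^sup>2"
      unfolding yw mult.assoc[of 2 y w] by (simp add: power2_eq_square algebra_simps)
    ultimately show ?thesis by (simp only: right_diff_distrib mult.assoc)
  qed
  also have "\<bar>\<dots>\<bar> \<le> 1 * (4 * \<bar>w\<bar> ^ 3)"
    unfolding abs_mult using kac_log_nonneg[of l s] by (intro mult_mono gauss_taylor) auto
  also have "\<bar>w\<bar> \<le> sqrt (l / 2) * \<bar>z\<bar>"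
    using a by (auto simp: w_def abs_mult intro!: mult_right_mono)
  then have "\<bar>w\<bar> ^ 3 \<le> (sqrt (l / 2) * \<bar>z\<bar>) ^ 3"
    by (intro power_mono) auto
  finally show ?thesis by (simp add: a_def power_mult_distrib)
qed

text \<open>The common factor \<open>kac l s x\<close> has been divided out: the first expression is
  the damped spatial expansion with the squared increment replaced by its variance \<open>d\<close>,
  the second is the ratio of \<open>kac l (s + d) x\<close> to \<open>kac l s x\<close>. The growth
  in \<open>x\<close> is affordable because the removed factor absorbs it by
  \<open>kac_times_poly_bound\<close>. The four summands of the constant are those of the bounds
  \<open>e1\<close> to \<open>e4\<close> in the proof.\<close>

lemma kac_time_taylor:
  assumes "0 < l" "0 \<le> s" "0 \<le> d" "d \<le> 1"
  shows "\<bar>exp (- (l\<^sup>2 / 2 * d * x\<^sup>2)) * (1 + (2 * (kac_quad l s)\<^sup>2 * x\<^sup>2 - kac_quad l s) * d)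
      - exp (- ((kac_log l (s + d) - kac_log l s) + (kac_quad l (s + d) - kac_quad l s) * x\<^sup>2))\<bar>
    \<le> (l ^ 4 + l\<^sup>2 * (l + l\<^sup>2) + (l + 2 * l\<^sup>2 + 2 * l ^ 3)\<^sup>2 + (l\<^sup>2 + 2 * l ^ 3)) * (d\<^sup>2 * (1 + x\<^sup>2)\<^sup>2)"
proof -
  define a where "a = kac_quad l s"
  define a1 where "a1 = kac_quad l (s + d)"
  define b where "b = kac_log l (s + d) - kac_log l s"
  define T where "T = 1 + x\<^sup>2"
  define u where "u = l\<^sup>2 / 2 * d * x\<^sup>2"
  define w where "w = 2 * a\<^sup>2 * x\<^sup>2 - a"
  define v where "v = b + (a1 - a) * x\<^sup>2"
  have a: "0 \<le> a" "a \<le> l / 2" using kac_quad_bounds[OF assms(1,2)] by (auto simp: a_def)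
  have a2: "0 \<le> a\<^sup>2" "a\<^sup>2 \<le> l\<^sup>2 / 4" using power_mono[OF a(2,1), of 2] by (simp_all add: power_divide)
  have T: "1 \<le> T" "x\<^sup>2 \<le> T" "0 \<le> T" "T \<le> T\<^sup>2"
    using one_le_power[of "1 + x\<^sup>2" 1] self_le_power[of "1 + x\<^sup>2" 2] unfolding T_def by simp_all
  have l2: "0 \<le> l\<^sup>2" "0 \<le> l ^ 3" using assms by auto
  have u: "0 \<le> u" "u \<le> l\<^sup>2 * (d * T)"
  proof -
    show "0 \<le> u" using assms by (simp add: u_def)
    have "u = l\<^sup>2 / 2 * (d * x\<^sup>2)" by (simp add: u_def)
    also have "\<dots> \<le> l\<^sup>2 * (d * T)"
      using assms T by (intro mult_mono) auto
    finally show "u \<le> l\<^sup>2 * (d * T)" .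
  qed
  have w: "\<bar>w\<bar> \<le> (l + l\<^sup>2) * T"
  proof -
    have "\<bar>w\<bar> \<le> 2 * a\<^sup>2 * x\<^sup>2 + a" using a by (simp add: w_def abs_le_iff)
    also have "\<dots> \<le> l\<^sup>2 * T + l * T"
    proof (intro add_mono mult_mono)
      show "2 * a\<^sup>2 \<le> l\<^sup>2" using a2 l2 by linarith
      have "a \<le> l * 1" using a assms by linarith
      also have "\<dots> \<le> l * T" using T assms by (intro mult_left_mono) auto
      finally show "a \<le> l * T" .
    qed (use T l2 in auto)
    finally show ?thesis by (simp add: algebra_simps)
  qed
  have vd: "\<bar>v - d * (a + (l\<^sup>2 / 2 - 2 * a\<^sup>2) * x\<^sup>2)\<bar> \<le> (l\<^sup>2 + 2 * l ^ 3) * (d\<^sup>2 * T)"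
  proof -
    have 1: "\<bar>b - d * a\<bar> \<le> l\<^sup>2 * d\<^sup>2"
      using kac_log_taylor[OF assms(1-3)] by (simp add: b_def a_def)
    have 2: "\<bar>a1 - a - d * (l\<^sup>2 / 2 - 2 * a\<^sup>2)\<bar> \<le> 2 * l ^ 3 * d\<^sup>2"
      using kac_quad_taylor[OF assms(1-3)] by (simp add: a1_def a_def)
    have "v - d * (a + (l\<^sup>2 / 2 - 2 * a\<^sup>2) * x\<^sup>2) = (b - d * a) + (a1 - a - d * (l\<^sup>2 / 2 - 2 * a\<^sup>2)) * x\<^sup>2"
      by (simp add: v_def algebra_simps)
    also have "\<bar>\<dots>\<bar> \<le> \<bar>b - d * a\<bar> + \<bar>a1 - a - d * (l\<^sup>2 / 2 - 2 * a\<^sup>2)\<bar> * x\<^sup>2"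
      by (rule order_trans[OF abs_triangle_ineq]) (simp add: abs_mult)
    also have "\<dots> \<le> l\<^sup>2 * d\<^sup>2 * 1 + 2 * l ^ 3 * d\<^sup>2 * x\<^sup>2"
      using 1 2 by (intro add_mono mult_right_mono) auto
    also have "\<dots> \<le> l\<^sup>2 * d\<^sup>2 * T + 2 * l ^ 3 * d\<^sup>2 * T"
      using T assms by (intro add_mono mult_left_mono) auto
    finally show ?thesis by (simp add: algebra_simps)
  qed
  have v: "0 \<le> v" "v \<le> (l + 2 * l\<^sup>2 + 2 * l ^ 3) * (d * T)"
  proof -
    show "0 \<le> v"
      using kac_log_mono[of l s "s + d"] kac_quad_mono[of l s "s + d"] assms
      by (simp add: v_def b_def a_def a1_def)
    have "(l\<^sup>2 / 2 - 2 * a\<^sup>2) * x\<^sup>2 \<le> l\<^sup>2 * T"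
    proof (intro mult_mono)
      show "l\<^sup>2 / 2 - 2 * a\<^sup>2 \<le> l\<^sup>2" using a2 l2 by linarith
    qed (use T l2 in auto)
    moreover have "a \<le> l * T"
      using a assms T mult_left_mono[of 1 T l] by linarith
    ultimately have "a + (l\<^sup>2 / 2 - 2 * a\<^sup>2) * x\<^sup>2 \<le> l * T + l\<^sup>2 * T" by linarith
    then have "d * (a + (l\<^sup>2 / 2 - 2 * a\<^sup>2) * x\<^sup>2) \<le> d * (l * T + l\<^sup>2 * T)"
      using assms by (intro mult_left_mono) auto
    moreover have "(l\<^sup>2 + 2 * l ^ 3) * (d\<^sup>2 * T) \<le> (l\<^sup>2 + 2 * l ^ 3) * (d * T)"
      using assms T l2 by (intro mult_left_mono mult_right_mono) (auto simp: power2_eq_square mult_left_le)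
    ultimately have "v \<le> d * (l * T + l\<^sup>2 * T) + (l\<^sup>2 + 2 * l ^ 3) * (d * T)"
      using vd by linarith
    then show "v \<le> (l + 2 * l\<^sup>2 + 2 * l ^ 3) * (d * T)" by (simp add: algebra_simps)
  qed
  have e1: "\<bar>exp (-u) - 1 + u\<bar> \<le> l ^ 4 * (d\<^sup>2 * T\<^sup>2)"
  proof -
    have "\<bar>exp (-u) - 1 + u\<bar> \<le> u\<^sup>2" by (rule exp_minus_taylor[OF u(1)])
    also have "\<dots> \<le> (l\<^sup>2 * (d * T))\<^sup>2" using u by (intro power_mono)
    finally show ?thesis by (simp add: power_mult_distrib)
  qed
  have e2: "\<bar>(1 - exp (-u)) * (w * d)\<bar> \<le> l\<^sup>2 * (l + l\<^sup>2) * (d\<^sup>2 * T\<^sup>2)"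
  proof -
    have "\<bar>1 - exp (-u)\<bar> \<le> u" using u exp_ge_add_one_self[of "-u"] by (simp add: abs_le_iff)
    then have "\<bar>(1 - exp (-u)) * (w * d)\<bar> \<le> (l\<^sup>2 * (d * T)) * ((l + l\<^sup>2) * T * d)"
      unfolding abs_mult using u w assms by (intro mult_mono) auto
    then show ?thesis by (simp add: power2_eq_square algebra_simps)
  qed
  have e3: "\<bar>exp (-v) - 1 + v\<bar> \<le> (l + 2 * l\<^sup>2 + 2 * l ^ 3)\<^sup>2 * (d\<^sup>2 * T\<^sup>2)"
  proof -
    have "\<bar>exp (-v) - 1 + v\<bar> \<le> v\<^sup>2" by (rule exp_minus_taylor[OF v(1)])
    also have "\<dots> \<le> ((l + 2 * l\<^sup>2 + 2 * l ^ 3) * (d * T))\<^sup>2" using v by (intro power_mono)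
    finally show ?thesis by (simp add: power_mult_distrib)
  qed
  have e4: "\<bar>v - u + w * d\<bar> \<le> (l\<^sup>2 + 2 * l ^ 3) * (d\<^sup>2 * T\<^sup>2)"
  proof -
    have "v - u + w * d = v - d * (a + (l\<^sup>2 / 2 - 2 * a\<^sup>2) * x\<^sup>2)"
      by (simp add: u_def w_def algebra_simps)
    also have "\<bar>\<dots>\<bar> \<le> (l\<^sup>2 + 2 * l ^ 3) * (d\<^sup>2 * T)" by (rule vd)
    also have "\<dots> \<le> (l\<^sup>2 + 2 * l ^ 3) * (d\<^sup>2 * T\<^sup>2)"
      using T l2 by (intro mult_left_mono) auto
    finally show ?thesis .
  qed
  \<comment> \<open>The first-order terms \<open>v - u + w * d\<close> cancel up to \<open>O(d\<^sup>2)\<close>: this is the backward equation.\<close>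
  have "exp (-u) * (1 + w * d) - exp (-v)
    = (exp (-u) - 1 + u) - (1 - exp (-u)) * (w * d) - (exp (-v) - 1 + v) + (v - u + w * d)"
    by (simp add: algebra_simps)
  then have "\<bar>exp (-u) * (1 + w * d) - exp (-v)\<bar>
    \<le> \<bar>exp (-u) - 1 + u\<bar> + \<bar>(1 - exp (-u)) * (w * d)\<bar> + \<bar>exp (-v) - 1 + v\<bar> + \<bar>v - u + w * d\<bar>"
    by linarith
  also have "\<dots> \<le> l ^ 4 * (d\<^sup>2 * T\<^sup>2) + l\<^sup>2 * (l + l\<^sup>2) * (d\<^sup>2 * T\<^sup>2)
     + (l + 2 * l\<^sup>2 + 2 * l ^ 3)\<^sup>2 * (d\<^sup>2 * T\<^sup>2) + (l\<^sup>2 + 2 * l ^ 3) * (d\<^sup>2 * T\<^sup>2)"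
    by (intro add_mono e1 e2 e3 e4)
  also have "\<dots> = (l ^ 4 + l\<^sup>2 * (l + l\<^sup>2) + (l + 2 * l\<^sup>2 + 2 * l ^ 3)\<^sup>2 + (l\<^sup>2 + 2 * l ^ 3)) * (d\<^sup>2 * T\<^sup>2)"
    by (simp only: distrib_right)
  finally show ?thesis
    by (simp only: u_def w_def v_def T_def a_def a1_def b_def)
qed

text \<open>A deterministic form of Ito's formula for one step: \<open>z\<close> is an arbitrary
  real number, and probability enters only afterwards, when the terms with \<open>z\<close> and
  \<open>z\<^sup>2 - d\<close> nearly average out given the past. The constant depends on
  \<open>l\<close> and \<open>e\<close> but neither on the position nor on the remaining time, so it
  can be pulled out of a sum over all steps.\<close>

lemma kac_one_step:
  assumes "0 < l" "0 < e"
  obtains C where "0 < C"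
    "\<And>s d x. e \<le> s \<Longrightarrow> 0 \<le> d \<Longrightarrow> \<bar>kac_drift l s d x\<bar> \<le> C"
    "\<And>s d x. e \<le> s \<Longrightarrow> 0 \<le> d \<Longrightarrow> \<bar>kac_curvature l s d x\<bar> \<le> C"
    "\<And>s d x z. e \<le> s \<Longrightarrow> 0 \<le> d \<Longrightarrow> d \<le> 1 \<Longrightarrow>
       \<bar>exp (- (l\<^sup>2 / 2 * d * x\<^sup>2)) * kac l s (x + z) - kac l (s + d) x
         - kac_drift l s d x * z - kac_curvature l s d x * (z\<^sup>2 - d)\<bar> \<le> C * (\<bar>z\<bar> ^ 3 + d\<^sup>2)"
proof -
  define Q where "Q = 2 * (1 + 1 / kac_quad l e)\<^sup>2"
  define K where "K = l ^ 4 + l\<^sup>2 * (l + l\<^sup>2) + (l + 2 * l\<^sup>2 + 2 * l ^ 3)\<^sup>2 + (l\<^sup>2 + 2 * l ^ 3)"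
  define R where "R = 4 * sqrt (l / 2) ^ 3"
  have Q: "kac l s x * (1 + x\<^sup>2)\<^sup>2 \<le> Q" if "e \<le> s" for s x
    using kac_times_poly_bound[OF assms that] by (simp add: Q_def)
  have nn: "0 \<le> Q" "0 \<le> K" "0 < R"
    using assms by (auto simp: Q_def K_def R_def intro!: add_nonneg_nonneg mult_nonneg_nonneg)
  define C where "C = l * Q + (l + l\<^sup>2) * Q + K * Q + R"
  have lQ: "0 \<le> l * Q" "0 \<le> (l + l\<^sup>2) * Q" "0 \<le> K * Q"
    using nn assms by (auto intro!: mult_nonneg_nonneg add_nonneg_nonneg)
  have C: "0 < C" "l * Q \<le> C" "(l + l\<^sup>2) * Q \<le> C" "K * Q \<le> C" "R \<le> C"
    using nn lQ unfolding C_def by linarith+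
  have E: "0 \<le> exp (- (l\<^sup>2 / 2 * d * x\<^sup>2))" "exp (- (l\<^sup>2 / 2 * d * x\<^sup>2)) \<le> 1" if "0 \<le> d" for d x :: real
    using that by auto
  have T: "\<bar>x\<bar> \<le> (1 + x\<^sup>2)\<^sup>2" "x\<^sup>2 \<le> (1 + x\<^sup>2)\<^sup>2" "1 \<le> (1 + x\<^sup>2)\<^sup>2" for x :: real
  proof -
    have "1 + x\<^sup>2 \<le> (1 + x\<^sup>2)\<^sup>2" by (rule self_le_power) auto
    then show "\<bar>x\<bar> \<le> (1 + x\<^sup>2)\<^sup>2" "x\<^sup>2 \<le> (1 + x\<^sup>2)\<^sup>2" "1 \<le> (1 + x\<^sup>2)\<^sup>2"
      using abs_le_one_plus_square[of x] zero_le_power2[of x] by linarith+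
  qed
  have key: "\<bar>exp (- (l\<^sup>2 / 2 * d * x\<^sup>2)) * kac l s x * r\<bar> \<le> c * Q"
    if "e \<le> s" "0 \<le> d" "0 \<le> c" "\<bar>r\<bar> \<le> c * (1 + x\<^sup>2)\<^sup>2" for s d x r c
  proof -
    have "\<bar>exp (- (l\<^sup>2 / 2 * d * x\<^sup>2)) * kac l s x * r\<bar> = exp (- (l\<^sup>2 / 2 * d * x\<^sup>2)) * (kac l s x * \<bar>r\<bar>)"
      using kac_pos[of l s x] by (simp add: abs_mult)
    also have "\<dots> \<le> 1 * (kac l s x * (c * (1 + x\<^sup>2)\<^sup>2))"
      using E[OF that(2)] that(4) kac_pos[of l s x] by (intro mult_mono) auto
    also have "\<dots> = c * (kac l s x * (1 + x\<^sup>2)\<^sup>2)" by simp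
    also have "\<dots> \<le> c * Q" using Q[OF that(1)] that(3) by (intro mult_left_mono)
    finally show ?thesis .
  qed
  show thesis
  proof (rule that[OF C(1)])
    fix s d x :: real assume s: "e \<le> s" "0 \<le> d"
    define a where "a = kac_quad l s"
    have a: "0 \<le> a" "a \<le> l / 2" using kac_quad_bounds[of l s] assms s by (auto simp: a_def)
    have a2: "0 \<le> a\<^sup>2" "a\<^sup>2 \<le> l\<^sup>2 / 4" using power_mono[OF a(2,1), of 2] by (simp_all add: power_divide)
    have "\<bar>- 2 * a * x\<bar> \<le> l * (1 + x\<^sup>2)\<^sup>2"
      using a T[of x] assms unfolding abs_mult by (intro mult_mono) auto
    from key[OF s _ this] assms C(2) show "\<bar>kac_drift l s d x\<bar> \<le> C"
      by (simp add: kac_drift_def a_def)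
    have "\<bar>2 * a\<^sup>2 * x\<^sup>2 - a\<bar> \<le> 2 * a\<^sup>2 * x\<^sup>2 + a * 1" using a by (simp add: abs_le_iff)
    also have "\<dots> \<le> l\<^sup>2 * (1 + x\<^sup>2)\<^sup>2 + l * (1 + x\<^sup>2)\<^sup>2"
    proof (intro add_mono mult_mono)
      show "2 * a\<^sup>2 \<le> l\<^sup>2" using a2 zero_le_power2[of l] by linarith
    qed (use a T[of x] assms in auto)
    finally have "\<bar>2 * a\<^sup>2 * x\<^sup>2 - a\<bar> \<le> (l + l\<^sup>2) * (1 + x\<^sup>2)\<^sup>2" by (simp add: algebra_simps)
    from key[OF s _ this] assms C(3) show "\<bar>kac_curvature l s d x\<bar> \<le> C"
      by (simp add: kac_curvature_def a_def)
  next
    fix s d x z :: real assume s: "e \<le> s" "0 \<le> d" "d \<le> 1"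
    define a where "a = kac_quad l s"
    define w where "w = 2 * a\<^sup>2 * x\<^sup>2 - a"
    define E' where "E' = exp (- (l\<^sup>2 / 2 * d * x\<^sup>2))"
    define k where "k = kac l s x"
    have s0: "0 \<le> s" using s assms by auto
    have k: "0 < k" by (simp add: k_def kac_pos)
    have k1: "kac l (s + d) x = k * exp (- ((kac_log l (s + d) - kac_log l s) + (kac_quad l (s + d) - kac_quad l s) * x\<^sup>2))"
      by (simp add: k_def kac_def exp_add[symmetric] algebra_simps)
    have 1: "\<bar>E' * (kac l s (x + z) - k * (1 - 2 * a * x * z + w * z\<^sup>2))\<bar> \<le> 1 * (R * \<bar>z\<bar> ^ 3)"
      using kac_space_taylor[OF assms(1) s0, of x z] E[OF s(2), of x] unfolding abs_mult
      by (intro mult_mono) (auto simp: E'_def k_def a_def w_def R_def)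
    have 2: "\<bar>E' * (k * (1 + w * d)) - kac l (s + d) x\<bar> \<le> K * Q * d\<^sup>2"
    proof -
      have "\<bar>E' * (k * (1 + w * d)) - kac l (s + d) x\<bar>
        = k * \<bar>E' * (1 + w * d) - exp (- ((kac_log l (s + d) - kac_log l s) + (kac_quad l (s + d) - kac_quad l s) * x\<^sup>2))\<bar>"
        using k unfolding k1 by (simp add: abs_mult[symmetric] right_diff_distrib abs_mult_pos' mult.left_commute)
      also have "\<dots> \<le> k * (K * (d\<^sup>2 * (1 + x\<^sup>2)\<^sup>2))"
        using kac_time_taylor[OF assms(1) s0 s(2,3), of x] k
        unfolding K_def E'_def w_def a_def by (intro mult_left_mono) auto
      also have "\<dots> = K * d\<^sup>2 * (k * (1 + x\<^sup>2)\<^sup>2)" by simp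
      also have "\<dots> \<le> K * d\<^sup>2 * Q"
        using Q[OF s(1)] nn by (intro mult_left_mono) (auto simp: k_def)
      finally show ?thesis by (simp add: mult_ac)
    qed
    \<comment> \<open>Writing \<open>z\<^sup>2\<close> as \<open>d + (z\<^sup>2 - d)\<close>
      separates the part that the time expansion compares with \<open>kac l (s + d) x\<close> from
      the fluctuation, which becomes the curvature term.\<close>
    have "E' * kac l s (x + z) - kac l (s + d) x - kac_drift l s d x * z - kac_curvature l s d x * (z\<^sup>2 - d)
      = E' * (kac l s (x + z) - k * (1 - 2 * a * x * z + w * z\<^sup>2)) + (E' * (k * (1 + w * d)) - kac l (s + d) x)"
      unfolding kac_drift_def kac_curvature_def E'_def[symmetric] a_def[symmetric] k_def[symmetric] w_def[symmetric]
      by (simp add: algebra_simps)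
    also have "\<bar>\<dots>\<bar> \<le> R * \<bar>z\<bar> ^ 3 + K * Q * d\<^sup>2"
      using 1 2 by linarith
    also have "\<dots> \<le> C * \<bar>z\<bar> ^ 3 + C * d\<^sup>2"
      using C by (intro add_mono mult_right_mono) auto
    finally show "\<bar>exp (- (l\<^sup>2 / 2 * d * x\<^sup>2)) * kac l s (x + z) - kac l (s + d) x
         - kac_drift l s d x * z - kac_curvature l s d x * (z\<^sup>2 - d)\<bar> \<le> C * (\<bar>z\<bar> ^ 3 + d\<^sup>2)"
      by (simp add: E'_def distrib_left)
  qed
qed

lemma measurable_kac [measurable]:
  "kac l s \<in> borel_measurable borel"
  "kac_drift l s d \<in> borel_measurable borel"
  "kac_curvature l s d \<in> borel_measurable borel"
  unfolding kac_def[abs_def] kac_drift_def[abs_def] kac_curvature_def[abs_def] by measurable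

subsection \<open>Chains close to Brownian motion\<close>

text \<open>
  Conditional expectations of the increments given \<open>F k\<close> are controlled by testing against \<open>F k\<close>-measurable
  functions bounded by \<open>1\<close>; one error bound \<open>err k\<close> serves for drift, variance, third moment and step size.
\<close>

definition near_brownian ::
  "'a measure \<Rightarrow> (nat \<Rightarrow> 'a measure) \<Rightarrow> (nat \<Rightarrow> 'a \<Rightarrow> real) \<Rightarrow> (nat \<Rightarrow> real) \<Rightarrow> (nat \<Rightarrow> real) \<Rightarrow> nat \<Rightarrow> bool" where
  "near_brownian M F Z d err n \<longleftrightarrow>
    (\<forall>k\<le>n. Z k \<in> borel_measurable M) \<and>
    (\<forall>k<n. subalgebra M (F k) \<and> (\<forall>j\<le>k. Z j \<in> borel_measurable (F k)) \<and>
      0 \<le> d k \<and> d k \<le> 1 \<and> (d k)\<^sup>2 \<le> err k \<and>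
      integrable M (\<lambda>\<omega>. \<bar>Z (Suc k) \<omega> - Z k \<omega>\<bar> ^ 3) \<and>
      (\<integral>\<omega>. \<bar>Z (Suc k) \<omega> - Z k \<omega>\<bar> ^ 3 \<partial>M) \<le> err k \<and>
      (\<forall>G \<in> borel_measurable (F k). (\<forall>\<omega>\<in>space M. \<bar>G \<omega>\<bar> \<le> 1) \<longrightarrow>
        \<bar>\<integral>\<omega>. G \<omega> * (Z (Suc k) \<omega> - Z k \<omega>) \<partial>M\<bar> \<le> err k \<and>
        \<bar>\<integral>\<omega>. G \<omega> * ((Z (Suc k) \<omega> - Z k \<omega>)\<^sup>2 - d k) \<partial>M\<bar> \<le> err k))"

lemma power_le_one_plus_cube:
  fixes x :: real
  assumes "0 \<le> x" "i \<le> 3"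
  shows "x ^ i \<le> 1 + x ^ 3"
proof (cases "x \<le> 1")
  case True
  then show ?thesis using power_le_one[of x i] zero_le_power[of x 3] assms by linarith
next
  case False
  then have "x ^ i \<le> x ^ 3" using assms by (intro power_increasing) auto
  then show ?thesis by simp
qed

lemma integrable_bounded_mult:
  fixes f G :: "'a \<Rightarrow> real"
  assumes "G \<in> borel_measurable M" "AE \<omega> in M. \<bar>G \<omega>\<bar> \<le> C" "integrable M f"
  shows "integrable M (\<lambda>\<omega>. G \<omega> * f \<omega>)"
proof (rule Bochner_Integration.integrable_bound[where f = "\<lambda>\<omega>. C * f \<omega>"])
  show "AE \<omega> in M. norm (G \<omega> * f \<omega>) \<le> norm (C * f \<omega>)"
    using assms(2) by eventually_elim (auto simp: abs_mult intro!: mult_right_mono)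
qed (use assms in auto)

text \<open>A telescoping sum in the manner of Lindeberg: \<open>T k\<close> combines the killing
  already suffered before \<open>k\<close> with the Feynman-Kac function for the remaining clock
  \<open>s k\<close>, so \<open>T n\<close> and \<open>T 0\<close> are the two integrals compared.
  Each step costs four times \<open>C * err k\<close>, once each for drift, variance, third moment
  and squared step size. Dividing the drift and curvature coefficients by \<open>C\<close> turns
  them into admissible test functions.\<close>

lemma (in prob_space) kac_chain:
  assumes nb: "near_brownian M F Z d err n" and l: "0 < l" and e: "0 < e" and C: "0 < C"
    and drift: "\<And>s d x. e \<le> s \<Longrightarrow> 0 \<le> d \<Longrightarrow> \<bar>kac_drift l s d x\<bar> \<le> C"
    and curv: "\<And>s d x. e \<le> s \<Longrightarrow> 0 \<le> d \<Longrightarrow> \<bar>kac_curvature l s d x\<bar> \<le> C"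
    and step: "\<And>s d x z. e \<le> s \<Longrightarrow> 0 \<le> d \<Longrightarrow> d \<le> 1 \<Longrightarrow>
       \<bar>exp (- (l\<^sup>2 / 2 * d * x\<^sup>2)) * kac l s (x + z) - kac l (s + d) x
         - kac_drift l s d x * z - kac_curvature l s d x * (z\<^sup>2 - d)\<bar> \<le> C * (\<bar>z\<bar> ^ 3 + d\<^sup>2)"
  shows "\<bar>(\<integral>\<omega>. exp (- (l\<^sup>2 / 2 * (\<Sum>k<n. d k * (Z k \<omega>)\<^sup>2))) * kac l e (Z n \<omega>) \<partial>M)
     - (\<integral>\<omega>. kac l (e + (\<Sum>k<n. d k)) (Z 0 \<omega>) \<partial>M)\<bar> \<le> 4 * C * (\<Sum>k<n. err k)"
proof -
  define P where "P k \<omega> = exp (- (l\<^sup>2 / 2 * (\<Sum>j<k. d j * (Z j \<omega>)\<^sup>2)))" for k \<omega>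
  define s where "s k = e + (\<Sum>j=k..<n. d j)" for k
  define T where "T k = (\<integral>\<omega>. P k \<omega> * kac l (s k) (Z k \<omega>) \<partial>M)" for k
  have Zm: "Z k \<in> borel_measurable M" if "k \<le> n" for k
    using nb that by (auto simp: near_brownian_def)
  have dk: "0 \<le> d k" "d k \<le> 1" if "k < n" for k
    using nb that by (auto simp: near_brownian_def)
  have se: "e \<le> s k" for k
    unfolding s_def using dk by (auto intro!: sum_nonneg)
  have P: "0 < P k \<omega>" "P k \<omega> \<le> 1" if "k \<le> n" for k \<omega>
    using that dk by (auto simp: P_def intro!: mult_nonneg_nonneg sum_nonneg)
  have Pm: "P k \<in> borel_measurable M" if "k \<le> n" for k
    unfolding P_def[abs_def] using Zm that by (intro borel_measurable_exp measurable_compose[OF _ borel_measurable_exp] borel_measurable_uminus borel_measurable_times borel_measurable_sum borel_measurable_power) auto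
  have int: "integrable M (\<lambda>\<omega>. P k \<omega> * kac l (s k) (Z k \<omega>))" if "k \<le> n" for k
  proof (rule integrable_const_bound[where B = 1])
    show "AE \<omega> in M. norm (P k \<omega> * kac l (s k) (Z k \<omega>)) \<le> 1"
    proof (rule AE_I2)
      fix \<omega>
      have "\<bar>P k \<omega>\<bar> * \<bar>kac l (s k) (Z k \<omega>)\<bar> \<le> 1 * 1"
        using P[OF that, of \<omega>] kac_pos[of l "s k" "Z k \<omega>"] kac_le_1[OF l, of "s k" "Z k \<omega>"] se[of k] e
        by (intro mult_mono) auto
      then show "norm (P k \<omega> * kac l (s k) (Z k \<omega>)) \<le> 1" by (simp add: abs_mult)
    qed
    show "(\<lambda>\<omega>. P k \<omega> * kac l (s k) (Z k \<omega>)) \<in> borel_measurable M"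
      using Pm[OF that] Zm[OF that] by measurable
  qed
  have T_step: "\<bar>T (Suc k) - T k\<bar> \<le> 4 * C * err k" if k: "k < n" for k
  proof -
    define z where "z \<omega> = Z (Suc k) \<omega> - Z k \<omega>" for \<omega>
    define G1 where "G1 \<omega> = P k \<omega> * kac_drift l (s (Suc k)) (d k) (Z k \<omega>)" for \<omega>
    define G2 where "G2 \<omega> = P k \<omega> * kac_curvature l (s (Suc k)) (d k) (Z k \<omega>)" for \<omega>
    \<comment> \<open>The residual is small at every point; the two terms subtracted from the
      increment are small only in the mean, because their coefficients are measurable with respect
      to the past.\<close>
    define R where "R \<omega> = P (Suc k) \<omega> * kac l (s (Suc k)) (Z (Suc k) \<omega>) - P k \<omega> * kac l (s k) (Z k \<omega>)
       - G1 \<omega> * z \<omega> - G2 \<omega> * ((z \<omega>)\<^sup>2 - d k)" for \<omega>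
    have sub: "subalgebra M (F k)" and ZF: "\<And>j. j \<le> k \<Longrightarrow> Z j \<in> borel_measurable (F k)"
      and z3: "integrable M (\<lambda>\<omega>. \<bar>z \<omega>\<bar> ^ 3)" "(\<integral>\<omega>. \<bar>z \<omega>\<bar> ^ 3 \<partial>M) \<le> err k"
      and d2: "(d k)\<^sup>2 \<le> err k"
      and G: "\<And>G. G \<in> borel_measurable (F k) \<Longrightarrow> (\<And>\<omega>. \<bar>G \<omega>\<bar> \<le> 1) \<Longrightarrow>
          \<bar>\<integral>\<omega>. G \<omega> * z \<omega> \<partial>M\<bar> \<le> err k \<and> \<bar>\<integral>\<omega>. G \<omega> * ((z \<omega>)\<^sup>2 - d k) \<partial>M\<bar> \<le> err k"
      using nb k unfolding near_brownian_def z_def by auto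
    have zm [measurable]: "z \<in> borel_measurable M"
      unfolding z_def[abs_def] using Zm k by (intro borel_measurable_diff) auto
    have zi: "integrable M (\<lambda>\<omega>. \<bar>z \<omega>\<bar> ^ i)" if "i \<le> 3" for i
      by (rule Bochner_Integration.integrable_bound[where f = "\<lambda>\<omega>. 1 + \<bar>z \<omega>\<bar> ^ 3"])
        (use z3 power_le_one_plus_cube[OF _ that] in auto)
    have z1: "integrable M z" using zi[of 1] by (simp add: integrable_abs_iff)
    have z2: "integrable M (\<lambda>\<omega>. (z \<omega>)\<^sup>2)" using zi[of 2] by simp
    have PF: "P k \<in> borel_measurable (F k)"
      unfolding P_def[abs_def] using ZF by (intro measurable_compose[OF _ borel_measurable_exp] borel_measurable_uminus borel_measurable_times borel_measurable_sum borel_measurable_power) auto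
    have GF: "G1 \<in> borel_measurable (F k)" "G2 \<in> borel_measurable (F k)"
      unfolding G1_def[abs_def] G2_def[abs_def]
      by (intro borel_measurable_times PF measurable_compose[OF ZF[OF order_refl]] measurable_kac)+
    have Gm: "G1 \<in> borel_measurable M" "G2 \<in> borel_measurable M"
      using GF measurable_from_subalg[OF sub] by auto
    have Gb: "\<bar>G1 \<omega>\<bar> \<le> C" "\<bar>G2 \<omega>\<bar> \<le> C" for \<omega>
    proof -
      have "\<bar>P k \<omega>\<bar> * \<bar>kac_drift l (s (Suc k)) (d k) (Z k \<omega>)\<bar> \<le> 1 * C"
        "\<bar>P k \<omega>\<bar> * \<bar>kac_curvature l (s (Suc k)) (d k) (Z k \<omega>)\<bar> \<le> 1 * C"
        using P[of k \<omega>] k drift[OF se dk(1)[OF k], of "Suc k" "Z k \<omega>"]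
          curv[OF se dk(1)[OF k], of "Suc k" "Z k \<omega>"] by (intro mult_mono; simp)+
      then show "\<bar>G1 \<omega>\<bar> \<le> C" "\<bar>G2 \<omega>\<bar> \<le> C" by (simp_all add: G1_def G2_def abs_mult)
    qed
    have i1: "integrable M (\<lambda>\<omega>. G1 \<omega> * z \<omega>)"
      using Gm Gb z1 by (intro integrable_bounded_mult[where C = C]) auto
    have i2: "integrable M (\<lambda>\<omega>. G2 \<omega> * ((z \<omega>)\<^sup>2 - d k))"
      using Gm Gb z2 by (intro integrable_bounded_mult[where C = C]) auto
    have b1: "\<bar>\<integral>\<omega>. G1 \<omega> * z \<omega> \<partial>M\<bar> \<le> C * err k"
    proof -
      have "\<bar>\<integral>\<omega>. (G1 \<omega> / C) * z \<omega> \<partial>M\<bar> \<le> err k"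
        using G[of "\<lambda>\<omega>. G1 \<omega> / C"] GF Gb C by (auto simp: divide_simps)
      then show ?thesis using C by (simp add: divide_simps abs_mult mult.commute)
    qed
    have b2: "\<bar>\<integral>\<omega>. G2 \<omega> * ((z \<omega>)\<^sup>2 - d k) \<partial>M\<bar> \<le> C * err k"
    proof -
      have "\<bar>\<integral>\<omega>. (G2 \<omega> / C) * ((z \<omega>)\<^sup>2 - d k) \<partial>M\<bar> \<le> err k"
        using G[of "\<lambda>\<omega>. G2 \<omega> / C"] GF Gb C by (auto simp: divide_simps)
      then show ?thesis using C by (simp add: divide_simps abs_mult mult.commute)
    qed
    have R: "\<bar>R \<omega>\<bar> \<le> C * (\<bar>z \<omega>\<bar> ^ 3 + (d k)\<^sup>2)" for \<omega>
    proof -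
      have "s k = s (Suc k) + d k" using k by (simp add: s_def sum.atLeast_Suc_lessThan)
      moreover have "P (Suc k) \<omega> = P k \<omega> * exp (- (l\<^sup>2 / 2 * d k * (Z k \<omega>)\<^sup>2))"
        by (simp add: P_def exp_add[symmetric] algebra_simps)
      moreover have "Z (Suc k) \<omega> = Z k \<omega> + z \<omega>" by (simp add: z_def)
      ultimately have "R \<omega> = P k \<omega> * (exp (- (l\<^sup>2 / 2 * d k * (Z k \<omega>)\<^sup>2)) * kac l (s (Suc k)) (Z k \<omega> + z \<omega>)
         - kac l (s (Suc k) + d k) (Z k \<omega>)
         - kac_drift l (s (Suc k)) (d k) (Z k \<omega>) * z \<omega>
         - kac_curvature l (s (Suc k)) (d k) (Z k \<omega>) * ((z \<omega>)\<^sup>2 - d k))" (is "_ = _ * ?r")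
        by (simp only: R_def G1_def G2_def right_diff_distrib mult.assoc)
      then have "\<bar>R \<omega>\<bar> = P k \<omega> * \<bar>?r\<bar>" using P[of k \<omega>] k by (simp add: abs_mult)
      also have "\<dots> \<le> 1 * (C * (\<bar>z \<omega>\<bar> ^ 3 + (d k)\<^sup>2))"
      proof (rule mult_mono)
        show "\<bar>?r\<bar> \<le> C * (\<bar>z \<omega>\<bar> ^ 3 + (d k)\<^sup>2)"
          by (rule step[OF se dk[OF k]])
      qed (use P[of k \<omega>] k in auto)
      finally show ?thesis by simp
    qed
    have iT: "integrable M (\<lambda>\<omega>. P k \<omega> * kac l (s k) (Z k \<omega>))"
      "integrable M (\<lambda>\<omega>. P (Suc k) \<omega> * kac l (s (Suc k)) (Z (Suc k) \<omega>))"
      using int k by auto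
    have iR: "integrable M R" unfolding R_def[abs_def]
      by (intro Bochner_Integration.integrable_diff i1 i2 iT)
    have "T (Suc k) - T k = (\<integral>\<omega>. R \<omega> \<partial>M) + (\<integral>\<omega>. G1 \<omega> * z \<omega> \<partial>M) + (\<integral>\<omega>. G2 \<omega> * ((z \<omega>)\<^sup>2 - d k) \<partial>M)"
      unfolding T_def R_def by (simp add: iT i1 i2)
    moreover have "\<bar>\<integral>\<omega>. R \<omega> \<partial>M\<bar> \<le> C * (err k + err k)"
    proof -
      have "\<bar>\<integral>\<omega>. R \<omega> \<partial>M\<bar> \<le> (\<integral>\<omega>. \<bar>R \<omega>\<bar> \<partial>M)" by (rule integral_abs_bound)
      also have "\<dots> \<le> (\<integral>\<omega>. C * (\<bar>z \<omega>\<bar> ^ 3 + (d k)\<^sup>2) \<partial>M)"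
        using R iR z3 by (intro integral_mono) auto
      also have "\<dots> = C * ((\<integral>\<omega>. \<bar>z \<omega>\<bar> ^ 3 \<partial>M) + (d k)\<^sup>2)"
        using z3 by (simp add: prob_space)
      also have "\<dots> \<le> C * (err k + err k)"
        using z3 d2 C by (intro mult_left_mono add_mono) auto
      finally show ?thesis .
    qed
    ultimately show ?thesis using b1 b2 by (simp add: algebra_simps)
  qed
  have "\<bar>T m - T 0\<bar> \<le> (\<Sum>k<m. 4 * C * err k)" if "m \<le> n" for m
    using that
  proof (induction m)
    case (Suc m)
    then show ?case using T_step[of m] by auto
  qed simp
  from this[of n] show ?thesis
    by (simp add: T_def P_def s_def sum_distrib_left atLeast0LessThan)
qed

lemma abs_exp_minus_diff_le:
  fixes x y :: real
  assumes "0 \<le> x" "0 \<le> y"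
  shows "\<bar>exp (-x) - exp (-y)\<bar> \<le> \<bar>x - y\<bar>"
proof -
  have *: "exp (-u) - exp (-v) \<le> v - u" "0 \<le> exp (-u) - exp (-v)" if "0 \<le> u" "u \<le> v" for u v :: real
  proof -
    have "exp (-u) - exp (-v) = exp (-u) * (1 - exp (-(v - u)))"
      by (simp add: algebra_simps exp_add[symmetric])
    also have "\<dots> \<le> 1 * (v - u)"
      using that exp_ge_add_one_self[of "-(v - u)"] by (intro mult_mono) (auto simp del: exp_ge_add_one_self)
    finally show "exp (-u) - exp (-v) \<le> v - u" by simp
  qed (use that in auto)
  show ?thesis using *[of x y] *[of y x] assms by (cases "x \<le> y") auto
qed

text \<open>
  The chain is run with terminal function \<open>kac l e\<close> instead of the constant \<open>1\<close>; replacing one by the other costs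
  only the second moment of the endpoint, and \<open>e\<close> tends to \<open>0\<close> after the limit in \<open>m\<close>.
\<close>

lemma (in prob_space) kac_limit:
  fixes n :: "nat \<Rightarrow> nat" and d err :: "nat \<Rightarrow> nat \<Rightarrow> real"
  assumes nb: "\<And>m. m0 \<le> m \<Longrightarrow> near_brownian M (F m) (Z m) (d m) (err m) (n m)" and l: "0 < l"
    and err: "(\<lambda>m. \<Sum>k<n m. err m k) \<longlonglongrightarrow> 0"
    and clock: "(\<lambda>m. \<Sum>k<n m. d m k) \<longlonglongrightarrow> 1"
    and start: "\<And>m. m0 \<le> m \<Longrightarrow> AE \<omega> in M. \<bar>Z m 0 \<omega>\<bar> \<le> r m" "r \<longlonglongrightarrow> 0"
    and final: "\<And>m. m0 \<le> m \<Longrightarrow> integrable M (\<lambda>\<omega>. (Z m (n m) \<omega>)\<^sup>2)"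
      "\<And>m. m0 \<le> m \<Longrightarrow> (\<integral>\<omega>. (Z m (n m) \<omega>)\<^sup>2 \<partial>M) \<le> K"
  shows "(\<lambda>m. \<integral>\<omega>. exp (- (l\<^sup>2 / 2 * (\<Sum>k<n m. d m k * (Z m k \<omega>)\<^sup>2))) \<partial>M) \<longlonglongrightarrow> exp (- kac_log l 1)"
proof -
  define E where "E m = (\<integral>\<omega>. exp (- (l\<^sup>2 / 2 * (\<Sum>k<n m. d m k * (Z m k \<omega>)\<^sup>2))) \<partial>M)" for m
  \<comment> \<open>These are the errors that survive the limit in \<open>m\<close>: the shift of
    the clock by \<open>e\<close>, and the exchange of the terminal function with 1, which costs the
    last two terms since 1 - exp (-q) \<le> q. The constant \<open>C\<close> of the one-step
    expansion depends on \<open>e\<close>, so \<open>e\<close> has to be fixed before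
    \<open>m\<close> grows.\<close>
  define h where "h e = \<bar>kac_log l (e + 1) - kac_log l 1\<bar> + kac_log l e + kac_quad l e * K" for e
  have cont: "continuous_on UNIV (kac_log l)" "continuous_on UNIV (kac_quad l)"
    using kac_log_deriv kac_quad_deriv by (auto intro!: continuous_at_imp_continuous_on DERIV_isCont)
  have bound: "\<exists>C. \<forall>m\<ge>m0. \<bar>E m - exp (- kac_log l 1)\<bar> \<le> 4 * C * (\<Sum>k<n m. err m k) + l / 2 * (r m)\<^sup>2
      + \<bar>kac_log l (e + (\<Sum>k<n m. d m k)) - kac_log l (e + 1)\<bar> + h e" if e: "0 < e" for e
  proof -
    obtain C where C: "0 < C" 
      "\<And>s d x. e \<le> s \<Longrightarrow> 0 \<le> d \<Longrightarrow> \<bar>kac_drift l s d x\<bar> \<le> C"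
      "\<And>s d x. e \<le> s \<Longrightarrow> 0 \<le> d \<Longrightarrow> \<bar>kac_curvature l s d x\<bar> \<le> C"
      "\<And>s d x z. e \<le> s \<Longrightarrow> 0 \<le> d \<Longrightarrow> d \<le> 1 \<Longrightarrow>
       \<bar>exp (- (l\<^sup>2 / 2 * d * x\<^sup>2)) * kac l s (x + z) - kac l (s + d) x
         - kac_drift l s d x * z - kac_curvature l s d x * (z\<^sup>2 - d)\<bar> \<le> C * (\<bar>z\<bar> ^ 3 + d\<^sup>2)"
      using kac_one_step[OF l e] by blast
    show ?thesis
    proof (intro exI allI impI)
      fix m assume m: "m0 \<le> m"
      define \<sigma> where "\<sigma> = e + (\<Sum>k<n m. d m k)"
      define P where "P \<omega> = exp (- (l\<^sup>2 / 2 * (\<Sum>k<n m. d m k * (Z m k \<omega>)\<^sup>2)))" for \<omega>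
      have Zm [measurable]: "Z m k \<in> borel_measurable M" if "k \<le> n m" for k
        using nb[OF m] that by (auto simp: near_brownian_def)
      have dk: "0 \<le> d m k" if "k < n m" for k
        using nb[OF m] that by (auto simp: near_brownian_def)
      have \<sigma>: "0 \<le> \<sigma>" using e dk by (auto simp: \<sigma>_def intro!: sum_nonneg add_nonneg_nonneg)
      have P: "0 \<le> P \<omega>" "P \<omega> \<le> 1" for \<omega>
        using dk by (auto simp: P_def intro!: mult_nonneg_nonneg sum_nonneg)
      have Pm: "P \<in> borel_measurable M"
        unfolding P_def[abs_def] using Zm by (intro measurable_compose[OF _ borel_measurable_exp] borel_measurable_uminus borel_measurable_times borel_measurable_sum borel_measurable_power) auto
      have Pi: "integrable M P"
        by (rule integrable_const_bound[where B = 1]) (use P Pm in auto)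
      have ki: "integrable M (\<lambda>\<omega>. kac l s (Z m k \<omega>))" if "0 \<le> s" "k \<le> n m" for s k
        by (rule integrable_const_bound[where B = 1])
          (use kac_le_1[OF l that(1)] kac_pos[of l s] Zm[OF that(2)] in \<open>auto simp: abs_of_pos\<close>)
      have Pki: "integrable M (\<lambda>\<omega>. P \<omega> * kac l e (Z m (n m) \<omega>))"
        by (rule integrable_bounded_mult[where C = 1]) (use Pm P ki[of e "n m"] e in auto)
      have 1: "\<bar>(\<integral>\<omega>. P \<omega> * kac l e (Z m (n m) \<omega>) \<partial>M) - (\<integral>\<omega>. kac l \<sigma> (Z m 0 \<omega>) \<partial>M)\<bar>
         \<le> 4 * C * (\<Sum>k<n m. err m k)"
        using kac_chain[OF nb[OF m] l e C] by (simp add: P_def \<sigma>_def)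
      have 2: "\<bar>E m - (\<integral>\<omega>. P \<omega> * kac l e (Z m (n m) \<omega>) \<partial>M)\<bar> \<le> kac_log l e + kac_quad l e * K"
      proof -
        let ?q = "\<lambda>\<omega>. kac_log l e + kac_quad l e * (Z m (n m) \<omega>)\<^sup>2"
        have pt: "\<bar>P \<omega> - P \<omega> * kac l e (Z m (n m) \<omega>)\<bar> \<le> ?q \<omega>" for \<omega>
        proof -
          have "\<bar>1 - kac l e (Z m (n m) \<omega>)\<bar> \<le> ?q \<omega>"
          proof -
            have "kac l e (Z m (n m) \<omega>) = exp (- ?q \<omega>)" by (simp add: kac_def)
            then show ?thesis
              using exp_ge_add_one_self[of "- ?q \<omega>"] kac_le_1[OF l, of e "Z m (n m) \<omega>"] e by linarith
          qed
          then have "P \<omega> * \<bar>1 - kac l e (Z m (n m) \<omega>)\<bar> \<le> 1 * ?q \<omega>"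
            using P[of \<omega>] by (intro mult_mono) auto
          moreover have "P \<omega> - P \<omega> * kac l e (Z m (n m) \<omega>) = P \<omega> * (1 - kac l e (Z m (n m) \<omega>))"
            by (simp add: algebra_simps)
          ultimately show ?thesis using P[of \<omega>] by (simp add: abs_mult)
        qed
        have "\<bar>E m - (\<integral>\<omega>. P \<omega> * kac l e (Z m (n m) \<omega>) \<partial>M)\<bar> = \<bar>\<integral>\<omega>. P \<omega> - P \<omega> * kac l e (Z m (n m) \<omega>) \<partial>M\<bar>"
          unfolding E_def P_def[symmetric] using Pi Pki by simp
        also have "\<dots> \<le> (\<integral>\<omega>. \<bar>P \<omega> - P \<omega> * kac l e (Z m (n m) \<omega>)\<bar> \<partial>M)"
          by (rule integral_abs_bound)
        also have "\<dots> \<le> (\<integral>\<omega>. ?q \<omega> \<partial>M)"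
          using Pi Pki final(1)[OF m] pt by (intro integral_mono) auto
        also have "\<dots> = kac_log l e + kac_quad l e * (\<integral>\<omega>. (Z m (n m) \<omega>)\<^sup>2 \<partial>M)"
          using final(1)[OF m] by (simp add: prob_space)
        also have "\<dots> \<le> kac_log l e + kac_quad l e * K"
          using final(2)[OF m] kac_quad_bounds(1)[OF l, of e] e by (intro add_left_mono mult_left_mono) auto
        finally show ?thesis .
      qed
      have 3: "\<bar>(\<integral>\<omega>. kac l \<sigma> (Z m 0 \<omega>) \<partial>M) - exp (- kac_log l \<sigma>)\<bar> \<le> l / 2 * (r m)\<^sup>2"
      proof -
        have "\<bar>(\<integral>\<omega>. kac l \<sigma> (Z m 0 \<omega>) \<partial>M) - exp (- kac_log l \<sigma>)\<bar> = \<bar>\<integral>\<omega>. kac l \<sigma> (Z m 0 \<omega>) - exp (- kac_log l \<sigma>) \<partial>M\<bar>"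
          using ki[OF \<sigma>, of 0] by (simp add: prob_space)
        also have "\<dots> \<le> (\<integral>\<omega>. \<bar>kac l \<sigma> (Z m 0 \<omega>) - exp (- kac_log l \<sigma>)\<bar> \<partial>M)"
          by (rule integral_abs_bound)
        also have "\<dots> \<le> (\<integral>\<omega>. l / 2 * (r m)\<^sup>2 \<partial>M)"
        proof (rule integral_mono_AE)
          show "AE \<omega> in M. \<bar>kac l \<sigma> (Z m 0 \<omega>) - exp (- kac_log l \<sigma>)\<bar> \<le> l / 2 * (r m)\<^sup>2"
            using start(1)[OF m]
          proof eventually_elim
            case (elim \<omega>)
            have "\<bar>kac l \<sigma> (Z m 0 \<omega>) - exp (- kac_log l \<sigma>)\<bar>
              \<le> \<bar>(kac_log l \<sigma> + kac_quad l \<sigma> * (Z m 0 \<omega>)\<^sup>2) - kac_log l \<sigma>\<bar>"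
              using abs_exp_minus_diff_le[of "kac_log l \<sigma> + kac_quad l \<sigma> * (Z m 0 \<omega>)\<^sup>2" "kac_log l \<sigma>"]
                kac_log_nonneg[of l \<sigma>] kac_quad_bounds(1)[OF l \<sigma>] by (simp add: kac_def)
            also have "\<dots> = kac_quad l \<sigma> * (Z m 0 \<omega>)\<^sup>2"
              using kac_quad_bounds(1)[OF l \<sigma>] by simp
            also have "\<dots> \<le> l / 2 * (r m)\<^sup>2"
              using kac_quad_bounds[OF l \<sigma>] l elim power_mono[OF elim, of 2] by (intro mult_mono) auto
            finally show ?case .
          qed
        qed (use ki[OF \<sigma>, of 0] in auto)
        finally show ?thesis by (simp add: prob_space)
      qed
      have 4: "\<bar>exp (- kac_log l \<sigma>) - exp (- kac_log l (e + 1))\<bar> \<le> \<bar>kac_log l \<sigma> - kac_log l (e + 1)\<bar>"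
        "\<bar>exp (- kac_log l (e + 1)) - exp (- kac_log l 1)\<bar> \<le> \<bar>kac_log l (e + 1) - kac_log l 1\<bar>"
        by (intro abs_exp_minus_diff_le kac_log_nonneg)+
      show "\<bar>E m - exp (- kac_log l 1)\<bar> \<le> 4 * C * (\<Sum>k<n m. err m k) + l / 2 * (r m)\<^sup>2
      + \<bar>kac_log l (e + (\<Sum>k<n m. d m k)) - kac_log l (e + 1)\<bar> + h e"
        using 1 2 3 4 unfolding h_def \<sigma>_def[symmetric] by linarith
    qed
  qed
  have h0: "(h \<longlongrightarrow> 0) (at_right 0)"
  proof -
    have "isCont (kac_log l) x" "isCont (kac_quad l) x" for x
      using cont by (auto simp: continuous_on_eq_continuous_at)
    then have "isCont h 0" unfolding h_def[abs_def]
      by (intro continuous_intros isCont_o2[of _ "\<lambda>e. e + 1" "kac_log l"]) auto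
    moreover have "h 0 = 0" by (simp add: h_def kac_log_def kac_quad_def)
    ultimately show ?thesis by (metis isCont_def tendsto_mono at_le top_greatest)
  qed
  show ?thesis unfolding E_def[symmetric]
  proof (rule LIMSEQ_I)
    fix \<epsilon> :: real assume "0 < \<epsilon>"
    then have "eventually (\<lambda>e. \<bar>h e\<bar> < \<epsilon> / 2) (at_right 0)"
      using tendstoD[OF h0, of "\<epsilon> / 2"] by (simp add: dist_real_def)
    then have "eventually (\<lambda>e. \<bar>h e\<bar> < \<epsilon> / 2 \<and> 0 < e) (at_right 0)"
      by (simp add: eventually_conj_iff eventually_at_right_less)
    then obtain e where e: "\<bar>h e\<bar> < \<epsilon> / 2" "0 < e"
      using eventually_happens[of _ "at_right (0::real)"] by auto
    obtain C where C: "\<And>m. m0 \<le> m \<Longrightarrow> \<bar>E m - exp (- kac_log l 1)\<bar> \<le> 4 * C * (\<Sum>k<n m. err m k) + l / 2 * (r m)\<^sup>2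
      + \<bar>kac_log l (e + (\<Sum>k<n m. d m k)) - kac_log l (e + 1)\<bar> + h e"
      using bound[OF e(2)] by blast
    have "isCont (kac_log l) (e + 1)" using cont by (auto simp: continuous_on_eq_continuous_at)
    then have "(\<lambda>m. kac_log l (e + (\<Sum>k<n m. d m k))) \<longlonglongrightarrow> kac_log l (e + 1)"
      by (rule isCont_tendsto_compose) (intro tendsto_intros clock)
    then have "(\<lambda>m. 4 * C * (\<Sum>k<n m. err m k) + l / 2 * (r m)\<^sup>2
      + \<bar>kac_log l (e + (\<Sum>k<n m. d m k)) - kac_log l (e + 1)\<bar>) \<longlonglongrightarrow> 4 * C * 0 + l / 2 * 0\<^sup>2 + \<bar>kac_log l (e + 1) - kac_log l (e + 1)\<bar>"
      by (intro tendsto_intros err start(2))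
    then have "eventually (\<lambda>m. 4 * C * (\<Sum>k<n m. err m k) + l / 2 * (r m)\<^sup>2
      + \<bar>kac_log l (e + (\<Sum>k<n m. d m k)) - kac_log l (e + 1)\<bar> < \<epsilon> / 2) sequentially"
      using \<open>0 < \<epsilon>\<close> by (intro order_tendstoD) auto
    then obtain M1 where M1: "\<And>m. M1 \<le> m \<Longrightarrow> 4 * C * (\<Sum>k<n m. err m k) + l / 2 * (r m)\<^sup>2
      + \<bar>kac_log l (e + (\<Sum>k<n m. d m k)) - kac_log l (e + 1)\<bar> < \<epsilon> / 2"
      by (auto simp: eventually_sequentially)
    show "\<exists>no. \<forall>m\<ge>no. norm (E m - exp (- kac_log l 1)) < \<epsilon>"
    proof (intro exI[of _ "max m0 M1"] allI impI)
      fix m assume "max m0 M1 \<le> m"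
      then have "m0 \<le> m" "M1 \<le> m" by auto
      then show "norm (E m - exp (- kac_log l 1)) < \<epsilon>"
        using C[OF \<open>m0 \<le> m\<close>] M1[OF \<open>M1 \<le> m\<close>] e(1) unfolding real_norm_def by linarith
    qed
  qed
qed

section \<open>From Laplace transforms to convergence in distribution\<close>

text \<open>
  A continuous step function of \<open>v \<ge> 0\<close> is a continuous function of \<open>exp (-v) \<in> {0..1}\<close>, hence uniformly close
  to a polynomial in \<open>exp (-v)\<close>, whose expectation is a combination of Laplace transforms at integers.
\<close>

lemma laplace_conv_imp_weak_conv:
  fixes \<mu> :: "nat \<Rightarrow> real measure" and \<nu> :: "real measure"
  assumes \<mu>: "\<And>n. real_distribution (\<mu> n)" and \<nu>: "real_distribution \<nu>"
    and nonneg: "\<And>n. AE v in \<mu> n. 0 \<le> v" "AE v in \<nu>. 0 \<le> v"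
    and conv: "\<And>t. 0 < t \<Longrightarrow> (\<lambda>n. \<integral>v. exp (- t * v) \<partial>\<mu> n) \<longlonglongrightarrow> (\<integral>v. exp (- t * v) \<partial>\<nu>)"
  shows "weak_conv_m \<mu> \<nu>"
proof (rule integral_cts_step_conv_imp_weak_conv[OF \<mu> \<nu>])
  fix x y :: real assume xy: "x < y"
  \<comment> \<open>The maximum keeps the logarithm away from 0. It does not change the values at
    \<open>exp (-v)\<close>, because \<open>cts_step x y\<close> vanishes from \<open>y\<close>
    on.\<close>
  define f where "f u = cts_step x y (- ln (max u (exp (-y))))" for u
  have f: "f (exp (-v)) = cts_step x y v" for v
  proof -
    have "max (exp (-v)) (exp (-y)) = exp (- min v y)" by (auto simp: max_def min_def)
    then show ?thesis using xy by (auto simp: f_def cts_step_def min_def)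
  qed
  have "continuous_on {0..1} f"
    unfolding f_def
  proof (rule continuous_on_compose2[of UNIV "cts_step x y"])
    show "continuous_on UNIV (cts_step x y)"
      by (intro uniformly_continuous_imp_continuous cts_step_uniformly_continuous xy)
    show "continuous_on {0..1} (\<lambda>u. - ln (max u (exp (-y))))"
      by (intro continuous_intros) (auto simp: max_def; metis exp_gt_zero less_le_not_le linear)
  qed auto
  then have approx: "\<exists>a n. \<forall>u\<in>{0..1}. \<bar>f u - (\<Sum>i\<le>n. a i * u ^ i)\<bar> < e" if "0 < e" for e
    using Stone_Weierstrass_real_polynomial_function[of "{0..1::real}" f e] that
    by (metis compact_Icc real_polynomial_function_iff_sum)
  show "(\<lambda>n. integral\<^sup>L (\<mu> n) (cts_step x y)) \<longlonglongrightarrow> integral\<^sup>L \<nu> (cts_step x y)"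
  proof (rule LIMSEQ_I)
    fix e :: real assume e: "0 < e"
    then obtain a m where am: "\<And>u. u \<in> {0..1} \<Longrightarrow> \<bar>f u - (\<Sum>i\<le>m. a i * u ^ i)\<bar> < e / 3"
      using approx[of "e / 3"] by (metis divide_pos_pos zero_less_numeral)
    define I where "I \<kappa> = (\<Sum>i\<le>m. a i * (\<integral>v. exp (- real i * v) \<partial>\<kappa>))" for \<kappa> :: "real measure"
    have close: "\<bar>integral\<^sup>L \<kappa> (cts_step x y) - I \<kappa>\<bar> \<le> e / 3"
      if "real_distribution \<kappa>" and pos: "AE v in \<kappa>. 0 \<le> v" for \<kappa>
    proof -
      interpret real_distribution \<kappa> by fact
      have ei: "integrable \<kappa> (\<lambda>v. exp (- real i * v))" for i
      proof (rule integrable_const_bound[where B = 1])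
        show "AE v in \<kappa>. norm (exp (- real i * v)) \<le> 1"
          using pos by eventually_elim simp
      qed simp
      have "I \<kappa> = (\<integral>v. (\<Sum>i\<le>m. a i * exp (- real i * v)) \<partial>\<kappa>)"
        unfolding I_def using ei by simp
      moreover have si: "integrable \<kappa> (\<lambda>v. \<Sum>i\<le>m. a i * exp (- real i * v))"
        using ei by (intro Bochner_Integration.integrable_sum) simp
      ultimately have "\<bar>integral\<^sup>L \<kappa> (cts_step x y) - I \<kappa>\<bar>
         = \<bar>\<integral>v. cts_step x y v - (\<Sum>i\<le>m. a i * exp (- real i * v)) \<partial>\<kappa>\<bar>"
        using integrable_cts_step[OF xy] by simp
      also have "\<dots> \<le> (\<integral>v. \<bar>cts_step x y v - (\<Sum>i\<le>m. a i * exp (- real i * v))\<bar> \<partial>\<kappa>)"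
        by (rule integral_abs_bound)
      also have "\<dots> \<le> (\<integral>v. e / 3 \<partial>\<kappa>)"
      proof (rule integral_mono_AE)
        show "AE v in \<kappa>. \<bar>cts_step x y v - (\<Sum>i\<le>m. a i * exp (- real i * v))\<bar> \<le> e / 3"
          using pos
        proof eventually_elim
          case (elim v)
          then show ?case
            using am[of "exp (-v)"] unfolding f by (simp add: exp_of_nat_mult[symmetric])
        qed
      qed (use si integrable_cts_step[OF xy] in auto)
      finally show ?thesis using prob_space by simp
    qed
    \<comment> \<open>The constant term of the polynomial needs the Laplace transform at 0, where it
      is the total mass 1 of every distribution involved.\<close>
    have conv': "(\<lambda>n. \<integral>v. exp (- real i * v) \<partial>\<mu> n) \<longlonglongrightarrow> (\<integral>v. exp (- real i * v) \<partial>\<nu>)" for i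
    proof (cases "i = 0")
      case True
      then show ?thesis
        using real_distribution.axioms(1)[OF \<mu>] real_distribution.axioms(1)[OF \<nu>]
        by (simp add: prob_space.prob_space)
    qed (use conv[of "real i"] in simp)
    then have "(\<lambda>n. I (\<mu> n)) \<longlonglongrightarrow> I \<nu>"
      unfolding I_def by (intro tendsto_intros)
    then obtain n0 where n0: "\<forall>n\<ge>n0. norm (I (\<mu> n) - I \<nu>) < e / 3"
      using LIMSEQ_D[of "\<lambda>n. I (\<mu> n)" "I \<nu>" "e / 3"] e by auto
    then show "\<exists>no. \<forall>n\<ge>no. norm (integral\<^sup>L (\<mu> n) (cts_step x y) - integral\<^sup>L \<nu> (cts_step x y)) < e"
    proof (intro exI[of _ n0] allI impI)
      fix n assume "n0 \<le> n"
      then have "\<bar>I (\<mu> n) - I \<nu>\<bar> < e / 3" using n0 by auto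
      then show "norm (integral\<^sup>L (\<mu> n) (cts_step x y) - integral\<^sup>L \<nu> (cts_step x y)) < e"
        using close[OF \<mu>[of n] nonneg(1)[of n]] close[OF \<nu> nonneg(2)] unfolding real_norm_def by linarith
    qed
  qed
qed

text \<open>Stated for a general target space \<open>N\<close> and with raw preimages, so that it
  serves both the memory variable with values in \<open>nat \<times> bool\<close> and the Gaussian
  increments. Preimages under f o Y are preimages under \<open>Y\<close>, hence both generated
  sigma-algebras lie inside the two families assumed independent.\<close>

lemma (in prob_space) expectation_indep_mult:
  fixes G :: "'a \<Rightarrow> real" and f :: "'b \<Rightarrow> real"
  assumes F: "subalgebra M F" and G: "G \<in> borel_measurable F" "integrable M G"
    and Y: "Y \<in> measurable M N" and indep: "indep_set (sets F) {Y -` A \<inter> space M | A. A \<in> sets N}"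
    and f: "f \<in> borel_measurable N" "integrable M (\<lambda>\<omega>. f (Y \<omega>))"
  shows "(\<integral>\<omega>. G \<omega> * f (Y \<omega>) \<partial>M) = (\<integral>\<omega>. G \<omega> \<partial>M) * (\<integral>\<omega>. f (Y \<omega>) \<partial>M)"
proof (rule indep_var_lebesgue_integral[OF _ G(2) f(2)])
  have GM: "G \<in> borel_measurable M" using measurable_from_subalg[OF F G(1)] .
  have spF: "space F = space M" using F by (simp add: subalgebra_def)
  have YM: "(\<lambda>\<omega>. f (Y \<omega>)) \<in> borel_measurable M"
    using Y f(1) by (rule measurable_compose)
  have S1: "sigma_sets (space M) {G -` A \<inter> space M | A. A \<in> sets borel} \<subseteq> sets F"
    unfolding spF[symmetric] by (rule sets.sigma_sets_subset) (use measurable_sets[OF G(1)] in auto)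
  have S2: "{(\<lambda>\<omega>. f (Y \<omega>)) -` A \<inter> space M | A. A \<in> sets borel} \<subseteq> {Y -` A \<inter> space M | A. A \<in> sets N}"
  proof safe
    fix A :: "real set" assume A: "A \<in> sets borel"
    have "(\<lambda>\<omega>. f (Y \<omega>)) -` A \<inter> space M = Y -` (f -` A \<inter> space N) \<inter> space M"
      using measurable_space[OF Y] by auto
    then show "\<exists>B. (\<lambda>\<omega>. f (Y \<omega>)) -` A \<inter> space M = Y -` B \<inter> space M \<and> B \<in> sets N"
      using measurable_sets[OF f(1) A] by blast
  qed
  \<comment> \<open>The preimages under \<open>Y\<close> are the sets of this algebra, so they are
    already closed under the operations of \<open>sigma_sets\<close>.\<close>
  define V where "V = vimage_algebra (space M) Y N"
  have V: "sets V = {Y -` A \<inter> space M | A. A \<in> sets N}" "space V = space M"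
    using measurable_space[OF Y] by (auto simp: V_def sets_vimage_algebra2)
  have S4: "sigma_sets (space M) {(\<lambda>\<omega>. f (Y \<omega>)) -` A \<inter> space M | A. A \<in> sets borel} \<subseteq> {Y -` A \<inter> space M | A. A \<in> sets N}"
    using sets.sigma_sets_subset[of _ V] S2 unfolding V by blast
  show "indep_var borel G borel (\<lambda>\<omega>. f (Y \<omega>))"
    unfolding indep_var_eq indep_set_def
  proof (intro conjI GM YM indep_sets_mono_sets[OF indep[unfolded indep_set_def]])
    fix b :: bool
    show "case_bool (sigma_sets (space M) {G -` A \<inter> space M | A. A \<in> sets borel})
       (sigma_sets (space M) {(\<lambda>\<omega>. f (Y \<omega>)) -` A \<inter> space M | A. A \<in> sets borel}) b
      \<subseteq> case_bool (sets F) {Y -` A \<inter> space M | A. A \<in> sets N} b"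
      using S1 S4 by (cases b) simp_all
  qed
qed

subsection \<open>The elephant random walk\<close>

context elephant_random_walk
begin

definition past :: "nat \<Rightarrow> 'a measure" where
  "past n = sigma (space M) (\<Union>k\<in>{1..n}. {X k -` A \<inter> space M | A. A \<in> sets borel})"

lemma space_past [simp]: "space (past n) = space M"
  by (simp add: past_def space_measure_of_conv)

lemma sets_past: "sets (past n) = past_events M X n"
  unfolding past_def past_events_def by (rule sets_measure_of) auto

lemma subalgebra_past: "subalgebra M (past n)"
proof -
  have "past_events M X n \<subseteq> sets M"
    unfolding past_events_def
    by (rule sets.sigma_sets_subset) (use step_measurable in \<open>auto intro: measurable_sets\<close>)
  then show ?thesis by (simp add: subalgebra_def sets_past)
qed

lemma measurable_step_past: "1 \<le> i \<Longrightarrow> i \<le> n \<Longrightarrow> X i \<in> borel_measurable (past n)"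
proof (rule measurableI)
  fix A :: "real set" assume "1 \<le> i" "i \<le> n" "A \<in> sets borel"
  then have "X i -` A \<inter> space M \<in> (\<Union>k\<in>{1..n}. {X k -` A \<inter> space M | A. A \<in> sets borel})"
    by (intro UN_I[of i]) auto
  then show "X i -` A \<inter> space (past n) \<in> sets (past n)"
    by (simp add: sets_past past_events_def sigma_sets.Basic)
qed simp

lemma measurable_position_past: "i \<le> n \<Longrightarrow> position X i \<in> borel_measurable (past n)"
  unfolding position_def[abs_def] using measurable_step_past by (intro borel_measurable_sum) auto

lemma measurable_position [measurable]: "position X i \<in> borel_measurable M"
  unfolding position_def[abs_def] using step_measurable by (intro borel_measurable_sum) auto

text \<open>Point masses of \<open>J\<close> are what is needed to write the next step as a finite
  sum over the possible memories.\<close>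

lemma memory_exists:
  assumes "1 \<le> n"
  shows "\<exists>J. J \<in> measurable M (count_space UNIV) \<and>
    (\<forall>i r. i \<in> {1..n} \<longrightarrow> prob {\<omega> \<in> space M. J \<omega> = (i, r)} = (if r then p else 1 - p) / n) \<and>
    (AE \<omega> in M. fst (J \<omega>) \<in> {1..n}) \<and>
    indep_set (sets (past n)) {J -` A \<inter> space M | A. A \<in> sets (count_space UNIV)} \<and>
    (AE \<omega> in M. X (Suc n) \<omega> = (if snd (J \<omega>) then X (fst (J \<omega>)) \<omega> else - X (fst (J \<omega>)) \<omega>))"
proof -
  define \<pi> where "\<pi> = pair_pmf (pmf_of_set {1..n}) (bernoulli_pmf p)"
  obtain J where J: "J \<in> measurable M (count_space UNIV)"
    "distr M (count_space UNIV) J = measure_pmf \<pi>"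
    "indep_set (past_events M X n) {J -` A \<inter> space M | A. A \<in> UNIV}"
    "AE \<omega> in M. X (Suc n) \<omega> = (case J \<omega> of (k, repeat) \<Rightarrow> if repeat then X k \<omega> else - X k \<omega>)"
    using next_step[OF assms] unfolding \<pi>_def by blast
  show ?thesis
  proof (intro exI[of _ J] conjI allI impI J(1))
    fix i r assume i: "i \<in> {1..n}"
    have "prob {\<omega> \<in> space M. J \<omega> = (i, r)} = measure (distr M (count_space UNIV) J) {(i, r)}"
      using J(1) by (subst measure_distr) (auto simp: vimage_def Int_def conj_commute)
    also have "\<dots> = pmf \<pi> (i, r)" by (simp add: J(2) measure_pmf_single)
    also have "\<dots> = (if r then p else 1 - p) / n"
      using i assms p_range by (cases r) (auto simp: \<pi>_def pmf_pair)
    finally show "prob {\<omega> \<in> space M. J \<omega> = (i, r)} = (if r then p else 1 - p) / n" .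
  next
    have "AE x in distr M (count_space UNIV) J. fst x \<in> {1..n}"
      unfolding J(2) using assms by (auto simp: AE_measure_pmf_iff \<pi>_def)
    then show "AE \<omega> in M. fst (J \<omega>) \<in> {1..n}"
      by (rule AE_distrD[OF J(1)])
  qed (use J(3,4) in \<open>simp_all add: sets_past split_beta\<close>)
qed

text \<open>Strong induction, because the step copied up to sign may be any of the earlier
  ones.\<close>

lemma abs_step: "1 \<le> n \<Longrightarrow> AE \<omega> in M. \<bar>X n \<omega>\<bar> = 1"
proof (induction n rule: less_induct)
  case (less n)
  show ?case
  proof (cases "n = 1")
    case True
    have [measurable]: "X (Suc 0) \<in> borel_measurable M" by (rule step_measurable) simp
    have "prob ({\<omega> \<in> space M. X 1 \<omega> = 1} \<union> {\<omega> \<in> space M. X 1 \<omega> = -1}) = 1"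
      by (subst finite_measure_Union) (use first_step_plus first_step_minus in auto)
    moreover have "{\<omega> \<in> space M. X 1 \<omega> = 1} \<union> {\<omega> \<in> space M. X 1 \<omega> = -1} = {\<omega> \<in> space M. \<bar>X 1 \<omega>\<bar> = 1}"
      by auto
    ultimately have "prob {\<omega> \<in> space M. \<bar>X 1 \<omega>\<bar> = 1} = 1" by simp
    then show ?thesis using True by (subst (asm) prob_Collect_eq_1) auto
  next
    case False
    with less.prems obtain m where m: "n = Suc m" "1 \<le> m" by (cases n) auto
    obtain J where J: "J \<in> measurable M (count_space UNIV)"
      "\<And>i r. i \<in> {1..m} \<Longrightarrow> prob {\<omega> \<in> space M. J \<omega> = (i, r)} = (if r then p else 1 - p) / m"
      "AE \<omega> in M. fst (J \<omega>) \<in> {1..m}"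
      "indep_set (sets (past m)) {J -` A \<inter> space M | A. A \<in> sets (count_space UNIV)}"
      "AE \<omega> in M. X (Suc m) \<omega> = (if snd (J \<omega>) then X (fst (J \<omega>)) \<omega> else - X (fst (J \<omega>)) \<omega>)"
      using memory_exists[OF m(2)] by blast
    have "AE \<omega> in M. \<forall>i\<in>{1..m}. \<bar>X i \<omega>\<bar> = 1"
      using less.IH m by (intro AE_finite_allI) auto
    with J(3,5) show ?thesis unfolding m(1)
      by eventually_elim auto
  qed
qed

lemma abs_position_le: "AE \<omega> in M. \<bar>position X n \<omega>\<bar> \<le> n"
proof -
  have "AE \<omega> in M. \<forall>i\<in>{1..n}. \<bar>X i \<omega>\<bar> = 1"
    using abs_step by (intro AE_finite_allI) auto
  then show ?thesis
  proof eventually_elim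
    case (elim \<omega>)
    have "\<bar>position X n \<omega>\<bar> \<le> (\<Sum>i=1..n. \<bar>X i \<omega>\<bar>)" unfolding position_def by (rule sum_abs)
    then show ?case using elim by simp
  qed
qed

text \<open>Splitting over the values (i, r) of \<open>J\<close> writes the next step as a sum of
  signed earlier steps times indicators independent of the past; the masses p/n and (1 - p)/n then
  combine to (2p - 1)/n. This is the conditional mean (2p - 1) S_n / n of the next step in tested
  form. The bound on \<open>G\<close> is only almost sure so that \<open>G\<close> may be the
  position itself, which is needed for the second moment.\<close>

lemma expectation_mult_next_step:
  assumes n: "1 \<le> n" and G: "G \<in> borel_measurable (past n)" and bd: "AE \<omega> in M. \<bar>G \<omega>\<bar> \<le> C"
  shows "(\<integral>\<omega>. G \<omega> * X (Suc n) \<omega> \<partial>M) = (2 * p - 1) / n * (\<integral>\<omega>. G \<omega> * position X n \<omega> \<partial>M)"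
proof -
  obtain J where J [measurable]: "J \<in> measurable M (count_space UNIV)"
    and Jp: "\<And>i r. i \<in> {1..n} \<Longrightarrow> prob {\<omega> \<in> space M. J \<omega> = (i, r)} = (if r then p else 1 - p) / n"
    and Jr: "AE \<omega> in M. fst (J \<omega>) \<in> {1..n}"
    and Ji: "indep_set (sets (past n)) {J -` A \<inter> space M | A. A \<in> sets (count_space UNIV)}"
    and JX: "AE \<omega> in M. X (Suc n) \<omega> = (if snd (J \<omega>) then X (fst (J \<omega>)) \<omega> else - X (fst (J \<omega>)) \<omega>)"
    using memory_exists[OF n] by blast
  define H where "H i \<omega> = G \<omega> * X i \<omega>" for i \<omega>
  have Hp: "H i \<in> borel_measurable (past n)" if "i \<in> {1..n}" for i
    unfolding H_def[abs_def] using G measurable_step_past[of i n] that by (intro borel_measurable_times) auto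
  have Hi: "integrable M (H i)" if "i \<in> {1..n}" for i
  proof (rule integrable_const_bound[where B = C])
    show "H i \<in> borel_measurable M" using measurable_from_subalg[OF subalgebra_past Hp[OF that]] .
    have "AE \<omega> in M. \<bar>X i \<omega>\<bar> = 1" using abs_step that by auto
    with bd show "AE \<omega> in M. norm (H i \<omega>) \<le> C"
      by eventually_elim (simp add: H_def abs_mult)
  qed
  define I :: "nat \<Rightarrow> bool \<Rightarrow> 'a \<Rightarrow> real" where "I i r \<omega> = indicator {(i, r)} (J \<omega>)" for i r \<omega>
  have Im [measurable]: "I i r \<in> borel_measurable M" for i r
    unfolding I_def[abs_def] by (rule measurable_compose[OF J]) simp
  have Ib: "\<bar>I i r \<omega>\<bar> \<le> 1" for i r \<omega> by (simp add: I_def)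
  have Iint: "integrable M (I i r)" for i r
    by (rule integrable_const_bound[where B = 1]) (use Ib in auto)
  have EI: "(\<integral>\<omega>. I i r \<omega> \<partial>M) = (if r then p else 1 - p) / n" if "i \<in> {1..n}" for i r
  proof -
    have "(\<integral>\<omega>. I i r \<omega> \<partial>M) = (\<integral>\<omega>. indicator {\<omega> \<in> space M. J \<omega> = (i, r)} \<omega> \<partial>M)"
      by (intro Bochner_Integration.integral_cong) (auto simp: I_def indicator_def)
    also have "\<dots> = prob {\<omega> \<in> space M. J \<omega> = (i, r)}" by simp
    finally show ?thesis using Jp[OF that] by simp
  qed
  have EHI: "(\<integral>\<omega>. H i \<omega> * I i r \<omega> \<partial>M) = (\<integral>\<omega>. H i \<omega> \<partial>M) * ((if r then p else 1 - p) / n)" if "i \<in> {1..n}" for i r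
    using expectation_indep_mult[OF subalgebra_past Hp[OF that] Hi[OF that] J Ji, of "indicator {(i, r)}"]
      Iint[of i r] EI[OF that, of r] unfolding I_def by simp
  have HIi: "integrable M (\<lambda>\<omega>. H i \<omega> * I i r \<omega>)" if "i \<in> {1..n}" for i r
  proof (rule Bochner_Integration.integrable_bound[OF Hi[OF that]])
    show "AE \<omega> in M. norm (H i \<omega> * I i r \<omega>) \<le> norm (H i \<omega>)"
      using Ib by (intro AE_I2) (auto simp: abs_mult intro!: mult_left_le)
    show "(\<lambda>\<omega>. H i \<omega> * I i r \<omega>) \<in> borel_measurable M"
      by (intro borel_measurable_times borel_measurable_integrable[OF Hi[OF that]] Im)
  qed
  have "AE \<omega> in M. G \<omega> * X (Suc n) \<omega> = (\<Sum>i=1..n. H i \<omega> * I i True \<omega> - H i \<omega> * I i False \<omega>)"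
    using Jr JX
  proof eventually_elim
    case (elim \<omega>)
    obtain i r where ir: "J \<omega> = (i, r)" by (cases "J \<omega>")
    have "(\<Sum>i'=1..n. H i' \<omega> * I i' True \<omega> - H i' \<omega> * I i' False \<omega>)
      = (\<Sum>i'=1..n. if i' = i then (if r then H i \<omega> else - H i \<omega>) else 0)"
      by (intro sum.cong) (auto simp: I_def ir)
    also have "\<dots> = (if r then H i \<omega> else - H i \<omega>)" using elim ir by (simp add: sum.delta)
    finally show ?case using elim ir by (simp add: H_def)
  qed
  then have "(\<integral>\<omega>. G \<omega> * X (Suc n) \<omega> \<partial>M) = (\<integral>\<omega>. (\<Sum>i=1..n. H i \<omega> * I i True \<omega> - H i \<omega> * I i False \<omega>) \<partial>M)"
  proof (rule integral_cong_AE[rotated 2])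
    show "(\<lambda>\<omega>. G \<omega> * X (Suc n) \<omega>) \<in> borel_measurable M"
      using measurable_from_subalg[OF subalgebra_past G] step_measurable[of "Suc n"] by (intro borel_measurable_times) auto
    show "(\<lambda>\<omega>. \<Sum>i=1..n. H i \<omega> * I i True \<omega> - H i \<omega> * I i False \<omega>) \<in> borel_measurable M"
      using HIi by (intro borel_measurable_sum borel_measurable_diff) auto
  qed
  also have "\<dots> = (\<Sum>i=1..n. (\<integral>\<omega>. H i \<omega> * I i True \<omega> \<partial>M) - (\<integral>\<omega>. H i \<omega> * I i False \<omega> \<partial>M))"
    using HIi by (subst Bochner_Integration.integral_sum) auto
  also have "\<dots> = (\<Sum>i=1..n. (2 * p - 1) / n * (\<integral>\<omega>. H i \<omega> \<partial>M))"
  proof (intro sum.cong refl)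
    fix i assume "i \<in> {1..n}"
    then have "(\<integral>\<omega>. H i \<omega> * I i True \<omega> \<partial>M) - (\<integral>\<omega>. H i \<omega> * I i False \<omega> \<partial>M)
      = (\<integral>\<omega>. H i \<omega> \<partial>M) * (p / n) - (\<integral>\<omega>. H i \<omega> \<partial>M) * ((1 - p) / n)"
      by (simp add: EHI)
    also have "\<dots> = (\<integral>\<omega>. H i \<omega> \<partial>M) * (p / n - (1 - p) / n)"
      by (simp only: right_diff_distrib)
    also have "p / n - (1 - p) / n = (2 * p - 1) / n"
      by (simp add: diff_divide_distrib[symmetric])
    finally show "(\<integral>\<omega>. H i \<omega> * I i True \<omega> \<partial>M) - (\<integral>\<omega>. H i \<omega> * I i False \<omega> \<partial>M)
      = (2 * p - 1) / n * (\<integral>\<omega>. H i \<omega> \<partial>M)"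
      by simp
  qed
  also have "\<dots> = (2 * p - 1) / n * (\<integral>\<omega>. (\<Sum>i=1..n. H i \<omega>) \<partial>M)"
    using Hi by (simp add: sum_distrib_left)
  finally show ?thesis by (simp add: H_def position_def sum_distrib_left)
qed

end

section \<open>Moments of the critical walk and its closeness to Brownian motion\<close>

text \<open>Each summand is at most \<open>2 * (sqrt (Suc n) - sqrt n)\<close>, so the sum
  telescopes. Logarithmic precision would gain nothing here: any power of n below the first keeps
  the error of the conditional variance summable.\<close>

lemma harm_le_2_sqrt: "harm n \<le> 2 * sqrt (real n)"
proof (induction n)
  case (Suc n)
  have "inverse (real (Suc n)) \<le> 2 * (sqrt (real (Suc n)) - sqrt (real n))"
  proof -
    define s t where "s = sqrt (real (Suc n))" and "t = sqrt (real n)"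
    have st: "1 \<le> s" "0 \<le> t" "t \<le> s" "s * s = real (Suc n)" "t * t = real n" by (auto simp: s_def t_def)
    have "(s - t) * (s + t) = 1" using st by (simp add: algebra_simps)
    then have "1 \<le> (s - t) * (2 * (s * s))"
      using mult_left_mono[of "s + t" "2 * (s * s)" "s - t"] mult_left_mono[of 1 s s] st by linarith
    then have "1 / (s * s) \<le> 2 * (s - t)"
      using st by (simp only: pos_divide_le_eq mult_pos_pos)
    then show ?thesis unfolding st(4) s_def t_def by (simp add: inverse_eq_divide)
  qed
  with Suc show ?case by (simp add: harm_Suc)
qed (simp add: harm_def)

text \<open>For the second bound, the gap is multiplied by the conjugate sum, which is at least 1;
  the difference of squares is exactly t^2 / 4. With t = 1/j this measures how well the change of
  the normaliser compensates the drift of the walk.\<close>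

lemma sqrt_one_plus_bounds:
  fixes t :: real
  assumes "0 \<le> t"
  shows "sqrt (1 + t) \<le> 1 + t / 2" "1 + t / 2 - sqrt (1 + t) \<le> t\<^sup>2 / 4"
proof -
  show le: "sqrt (1 + t) \<le> 1 + t / 2"
    using assms by (intro real_le_lsqrt) (auto simp: power2_eq_square algebra_simps)
  have "1 \<le> sqrt (1 + t)" using assms by simp
  then have "(1 + t / 2 - sqrt (1 + t)) * 1 \<le> (1 + t / 2 - sqrt (1 + t)) * (1 + t / 2 + sqrt (1 + t))"
    using le assms by (intro mult_left_mono) auto
  also have "\<dots> = (1 + t / 2)\<^sup>2 - (sqrt (1 + t))\<^sup>2"
    by (simp add: power2_eq_square algebra_simps)
  also have "\<dots> = t\<^sup>2 / 4" using assms by (simp add: power2_eq_square algebra_simps)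
  finally show "1 + t / 2 - sqrt (1 + t) \<le> t\<^sup>2 / 4" by simp
qed

context elephant_random_walk
begin

lemma integrable_position_power: "integrable M (\<lambda>\<omega>. position X n \<omega> ^ i)"
proof (rule integrable_const_bound[where B = "real n ^ i"])
  show "AE \<omega> in M. norm (position X n \<omega> ^ i) \<le> real n ^ i"
    using abs_position_le[of n] by eventually_elim (simp add: power_abs power_mono)
qed simp

lemma position_Suc: "position X (Suc n) \<omega> = position X n \<omega> + X (Suc n) \<omega>"
  by (simp add: position_def)

text \<open>For p = 3/4 the conditional mean of the next step is S_n / (2n), so the cross term
  contributes E S_n^2 / n and E S_{n+1}^2 = (1 + 1/n) E S_n^2 + 1. Divided by n + 1, the recursion
  adds 1 / (n + 1) at each step, whence the harmonic number.\<close>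

lemma expectation_position_square:
  assumes "p = 3/4" "1 \<le> n"
  shows "(\<integral>\<omega>. (position X n \<omega>)\<^sup>2 \<partial>M) = n * harm n"
  using assms(2)
proof (induction n rule: dec_induct)
  case base
  have "(\<integral>\<omega>. (position X 1 \<omega>)\<^sup>2 \<partial>M) = (\<integral>\<omega>. 1 \<partial>M)"
  proof (rule integral_cong_AE)
    show "AE \<omega> in M. (position X 1 \<omega>)\<^sup>2 = 1"
      using abs_step[of 1] by (auto simp: position_def abs_square_eq_1)
  qed auto
  then show ?case using prob_space by (simp add: harm_def)
next
  case (step n)
  let ?S = "position X n" and ?X = "X (Suc n)"
  have Xm: "?X \<in> borel_measurable M" by (rule step_measurable) simp
  have iS: "integrable M (\<lambda>\<omega>. (?S \<omega>)\<^sup>2)" by (rule integrable_position_power)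
  have iSX: "integrable M (\<lambda>\<omega>. ?S \<omega> * ?X \<omega>)"
  proof (rule integrable_const_bound[where B = "real n"])
    show "AE \<omega> in M. norm (?S \<omega> * ?X \<omega>) \<le> real n"
      using abs_position_le[of n] abs_step[of "Suc n", simplified] by eventually_elim (simp add: abs_mult)
  qed (use Xm in auto)
  have "(\<integral>\<omega>. ?S \<omega> * ?X \<omega> \<partial>M) = (2 * p - 1) / n * (\<integral>\<omega>. ?S \<omega> * ?S \<omega> \<partial>M)"
    by (rule expectation_mult_next_step[OF step(1) measurable_position_past[OF order_refl] abs_position_le])
  then have SX: "(\<integral>\<omega>. ?S \<omega> * ?X \<omega> \<partial>M) = harm n / 2"
    using step assms by (simp add: power2_eq_square)
  have "(\<integral>\<omega>. (position X (Suc n) \<omega>)\<^sup>2 \<partial>M) = (\<integral>\<omega>. (?S \<omega>)\<^sup>2 + 2 * (?S \<omega> * ?X \<omega>) + 1 \<partial>M)"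
  proof (rule integral_cong_AE)
    show "AE \<omega> in M. (position X (Suc n) \<omega>)\<^sup>2 = (?S \<omega>)\<^sup>2 + 2 * (?S \<omega> * ?X \<omega>) + 1"
      using abs_step[of "Suc n", simplified]
    proof eventually_elim
      case (elim \<omega>)
      then have "(?X \<omega>)\<^sup>2 = 1" by (simp add: abs_square_eq_1)
      then show ?case by (simp add: position_Suc power2_sum)
    qed
  qed (use Xm in auto)
  also have "\<dots> = n * harm n + 2 * (harm n / 2) + 1"
    using iS iSX prob_space step SX by simp
  also have "\<dots> = real (Suc n) * harm (Suc n)"
    by (simp add: harm_Suc field_simps)
  finally show ?case .
qed

text \<open>The inequality |S| \<le> S^2 / (2v) + v / 2 is used with v = n^(3/4), the square root of
  the order n^(3/2) available for the second moment. The gain over |S_n| \<le> n is essential: the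
  variance error of a step is of order |S_j| / j^2 up to log n, and the trivial bound would only
  give the non-summable 1/j.\<close>

lemma expectation_abs_position_le:
  assumes "p = 3/4" "1 \<le> n"
  shows "(\<integral>\<omega>. \<bar>position X n \<omega>\<bar> \<partial>M) \<le> 2 * real n powr (3/4)"
proof -
  define v where "v = real n powr (3/4)"
  have v: "0 < v" "v * v = n * sqrt (real n)"
    using assms by (simp_all add: v_def powr_half_sqrt[symmetric] powr_add[symmetric] powr_mult_base)
  have i1: "integrable M (\<lambda>\<omega>. \<bar>position X n \<omega>\<bar>)" using integrable_position_power[of n 1] by simp
  have i2: "integrable M (\<lambda>\<omega>. (position X n \<omega>)\<^sup>2)" by (rule integrable_position_power)
  have "(\<integral>\<omega>. \<bar>position X n \<omega>\<bar> \<partial>M) \<le> (\<integral>\<omega>. (position X n \<omega>)\<^sup>2 / (2 * v) + v / 2 \<partial>M)"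
  proof (intro integral_mono i1)
    fix \<omega>
    have "0 \<le> (\<bar>position X n \<omega>\<bar> - v)\<^sup>2" by simp
    then have "\<bar>position X n \<omega>\<bar> * (2 * v) \<le> (position X n \<omega>)\<^sup>2 + v * v"
      by (simp add: power2_diff power2_eq_square algebra_simps)
    then show "\<bar>position X n \<omega>\<bar> \<le> (position X n \<omega>)\<^sup>2 / (2 * v) + v / 2"
      using v(1) by (simp add: field_simps)
  qed (use i2 in auto)
  also have "\<dots> = n * harm n / (2 * v) + v / 2"
    using i2 prob_space expectation_position_square[OF assms] by simp
  also have "\<dots> \<le> 2 * (v * v) / (2 * v) + v / 2"
  proof (intro add_mono divide_right_mono order_refl)
    have "real n * harm n \<le> real n * (2 * sqrt (real n))"
      by (intro mult_left_mono harm_le_2_sqrt) auto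
    then show "real n * harm n \<le> 2 * (v * v)" using v(2) by simp
  qed (use v in auto)
  also have "\<dots> \<le> 2 * v" using v(1) by simp
  finally show ?thesis by (simp add: v_def)
qed

text \<open>
  Index \<open>k\<close> of the chain is time \<open>k + 1\<close> of the walk. Since \<open>S\<^sub>j/\<surd>j\<close> is only almost a martingale, its drift
  is \<open>S\<^sub>j\<close> times \<open>a / (2 * j) + a - b\<close> below, which is of order \<open>j\<^sup>-\<^sup>5\<^sup>/\<^sup>2\<close> and therefore summable already with
  the trivial bound \<open>\<bar>S\<^sub>j\<bar> \<le> j\<close>.
\<close>

lemma near_brownian_position:
  fixes L :: real
  assumes p: "p = 3/4" and L: "1 \<le> L"
  shows "near_brownian M (\<lambda>k. past (Suc k)) (\<lambda>k \<omega>. position X (Suc k) \<omega> / sqrt (real (Suc k) * L))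
    (\<lambda>k. 1 / (real (Suc k) * L)) (\<lambda>k. 4 / (real (Suc k) powr (5/4) * sqrt L)) n"
proof -
  let ?Z = "\<lambda>k \<omega>. position X (Suc k) \<omega> / sqrt (real (Suc k) * L)"
  have meas: "?Z j \<in> borel_measurable (past (Suc k))" if "j \<le> k" for j k
    using measurable_position_past[of "Suc j" "Suc k"] that by auto
  have step: "0 \<le> 1 / (j * L) \<and> 1 / (j * L) \<le> 1 \<and> (1 / (j * L))\<^sup>2 \<le> 4 / (j powr (5/4) * sqrt L) \<and>
      integrable M (\<lambda>\<omega>. \<bar>?Z (Suc k) \<omega> - ?Z k \<omega>\<bar> ^ 3) \<and>
      (\<integral>\<omega>. \<bar>?Z (Suc k) \<omega> - ?Z k \<omega>\<bar> ^ 3 \<partial>M) \<le> 4 / (j powr (5/4) * sqrt L) \<and>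
      (\<forall>G \<in> borel_measurable (past (Suc k)). (\<forall>\<omega>\<in>space M. \<bar>G \<omega>\<bar> \<le> 1) \<longrightarrow>
        \<bar>\<integral>\<omega>. G \<omega> * (?Z (Suc k) \<omega> - ?Z k \<omega>) \<partial>M\<bar> \<le> 4 / (j powr (5/4) * sqrt L) \<and>
        \<bar>\<integral>\<omega>. G \<omega> * ((?Z (Suc k) \<omega> - ?Z k \<omega>)\<^sup>2 - 1 / (j * L)) \<partial>M\<bar> \<le> 4 / (j powr (5/4) * sqrt L))"
    if j: "j = real (Suc k)" for k j
  proof -
    define S Y z where "S = position X (Suc k)" and "Y = X (Suc (Suc k))" and "z \<omega> = ?Z (Suc k) \<omega> - ?Z k \<omega>" for \<omega>
    \<comment> \<open>The normalisers at times j + 1 and j. The increment is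
      \<open>a * Y - (b - a) * S\<close>, and b - a is close to a / (2j), the coefficient of
      \<open>S\<close> in the conditional mean of \<open>a * Y\<close>; the two cancel to leading
      order.\<close>
    define a b where "a = 1 / sqrt ((j + 1) * L)" and "b = 1 / sqrt (j * L)"
    \<comment> \<open>The exponent 5/4 is 2 - 3/4, from the variance error |S| / (j^2 L) and the
      first moment j^(3/4); the other errors decay at least like j^(-3/2). The factor
      \<open>sqrt L\<close> is what the drift error, of order j^(-3/2) L^(-1/2), allows. The
      numerator 4 covers 27/8 from the third moment and 1 + 5/2 from the variance.\<close>
    define w where "w = j powr (5/4) * sqrt L"
    have j1: "1 \<le> j" using j by simp
    have w0: "0 < w" using j1 L by (simp add: w_def)
    have sL: "1 \<le> sqrt L" "sqrt L * sqrt L = L" "sqrt L \<le> L"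
      using L mult_left_mono[of 1 "sqrt L" "sqrt L"] by auto
    have sj: "1 \<le> sqrt j" "sqrt j * sqrt j = j" using j1 by auto
    have w1: "w \<le> (j * sqrt j) * sqrt L"
    proof -
      have "j powr (5/4) \<le> j powr (3/2)" using j1 by (intro powr_mono) auto
      also have "\<dots> = j * sqrt j" using j1 by (simp add: powr_half_sqrt[symmetric] powr_mult_base)
      finally show ?thesis unfolding w_def using sL by (intro mult_right_mono) auto
    qed
    have w2: "w \<le> j\<^sup>2 * L"
    proof -
      have "j powr (5/4) \<le> j powr 2" using j1 by (intro powr_mono) auto
      then show ?thesis unfolding w_def using sL j1 by (intro mult_mono) (auto simp: powr_numeral)
    qed
    have w3: "w * j powr (3/4) \<le> j\<^sup>2 * L"
    proof -
      have "w * j powr (3/4) = j powr 2 * sqrt L"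
        by (simp add: w_def powr_add[symmetric] mult.commute mult.left_commute)
      then show ?thesis using sL j1 by (simp add: powr_numeral mult_left_mono)
    qed
    have b0: "0 < b" "b * b = 1 / (j * L)" and a0: "0 < a" "a * a = 1 / ((j + 1) * L)"
      using j1 L by (auto simp: a_def b_def)
    have ab: "b = a * sqrt (1 + 1 / j)"
    proof -
      have "(j + 1) * L = (1 + 1 / j) * (j * L)" using j1 by (simp add: field_simps)
      then have "sqrt ((j + 1) * L) = sqrt (1 + 1 / j) * sqrt (j * L)" by (simp only: real_sqrt_mult)
      moreover have "0 < sqrt (1 + 1 / j)" using j1 by (simp add: add_pos_pos)
      ultimately show ?thesis by (simp add: a_def b_def)
    qed
    have aleb: "a \<le> b" unfolding ab using a0 j1 by (simp add: mult_le_cancel_left1)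
    have ba: "b - a \<le> a / (2 * j)"
    proof -
      have "a * sqrt (1 + 1 / j) \<le> a * (1 + 1 / j / 2)"
        using a0 j1 by (intro mult_left_mono sqrt_one_plus_bounds) auto
      then show ?thesis unfolding ab by (simp add: algebra_simps)
    qed
    have bab: "\<bar>a / (2 * j) + a - b\<bar> \<le> b / (4 * j\<^sup>2)"
    proof -
      have "a / (2 * j) + a - b = a * (1 + 1 / j / 2 - sqrt (1 + 1 / j))"
        unfolding ab by (simp add: algebra_simps)
      also have "\<dots> \<le> a * ((1 / j)\<^sup>2 / 4)"
        using a0 j1 by (intro mult_left_mono sqrt_one_plus_bounds) auto
      also have "\<dots> = a / (4 * j\<^sup>2)" by (simp add: power_divide)
      also have "\<dots> \<le> b / (4 * j\<^sup>2)" using aleb by (intro divide_right_mono) auto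
      finally show ?thesis using ba by simp
    qed
    have z: "z \<omega> = a * Y \<omega> + (a - b) * S \<omega>" for \<omega>
      using j by (simp add: z_def a_def b_def S_def Y_def position_Suc algebra_simps add_divide_distrib)
    have Sm: "S \<in> borel_measurable M" and Ym: "Y \<in> borel_measurable M"
      unfolding S_def Y_def by (auto intro: step_measurable)
    then have zm: "z \<in> borel_measurable M" unfolding z[abs_def] by auto
    have bdS: "AE \<omega> in M. \<bar>S \<omega>\<bar> \<le> j" using abs_position_le[of "Suc k"] j by (simp add: S_def)
    have bdY: "AE \<omega> in M. \<bar>Y \<omega>\<bar> = 1" unfolding Y_def by (rule abs_step) simp
    have ES: "(\<integral>\<omega>. \<bar>S \<omega>\<bar> \<partial>M) \<le> 2 * j powr (3/4)"
      using expectation_abs_position_le[OF p, of "Suc k"] j by (simp add: S_def)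
    have iS: "integrable M (\<lambda>\<omega>. \<bar>S \<omega>\<bar>)" unfolding S_def using integrable_position_power[of "Suc k" 1] by simp
    have bdz: "AE \<omega> in M. \<bar>z \<omega>\<bar> \<le> 3/2 * b"
      using bdS bdY
    proof eventually_elim
      case (elim \<omega>)
      have "\<bar>z \<omega>\<bar> \<le> \<bar>a * Y \<omega>\<bar> + \<bar>(a - b) * S \<omega>\<bar>" unfolding z by (rule abs_triangle_ineq)
      also have "\<dots> = a + (b - a) * \<bar>S \<omega>\<bar>" using elim a0 aleb by (simp add: abs_mult)
      also have "\<dots> \<le> a + a / (2 * j) * j"
        using elim ba aleb a0 j1 by (intro add_mono mult_mono) auto
      also have "\<dots> \<le> 3/2 * b" using aleb j1 by simp
      finally show ?case .
    qed
    have d2: "(1 / (j * L))\<^sup>2 \<le> 4 / w"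
    proof -
      have "w \<le> j\<^sup>2 * L\<^sup>2"
        using w2 mult_left_mono[of L "L\<^sup>2" "j\<^sup>2"] L self_le_power[of L 2] by auto
      then have "1 / (j\<^sup>2 * L\<^sup>2) \<le> 1 / w" using w0 by (intro divide_left_mono) auto
      also have "\<dots> \<le> 4 / w" using w0 by (intro divide_right_mono) auto
      finally show ?thesis by (simp add: power_divide power_mult_distrib)
    qed
    have i3: "integrable M (\<lambda>\<omega>. \<bar>z \<omega>\<bar> ^ 3)"
    proof (rule integrable_const_bound[where B = "(3/2 * b) ^ 3"])
      show "AE \<omega> in M. norm (\<bar>z \<omega>\<bar> ^ 3) \<le> (3/2 * b) ^ 3"
        using bdz by eventually_elim (simp only: real_norm_def power_abs abs_abs, intro power_mono, auto)
    qed (use zm in auto)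
    have e3: "(\<integral>\<omega>. \<bar>z \<omega>\<bar> ^ 3 \<partial>M) \<le> 4 / w"
    proof -
      have "(\<integral>\<omega>. \<bar>z \<omega>\<bar> ^ 3 \<partial>M) \<le> (\<integral>\<omega>. (3/2 * b) ^ 3 \<partial>M)"
      proof (rule integral_mono_AE[OF i3])
        show "AE \<omega> in M. \<bar>z \<omega>\<bar> ^ 3 \<le> (3/2 * b) ^ 3"
          using bdz by eventually_elim (intro power_mono, auto)
      qed simp
      also have "\<dots> = 27/8 * (b * b * b)" using prob_space by (simp add: power3_eq_cube)
      also have "\<dots> \<le> 4 * (b * b * b)" using b0(1) by (intro mult_right_mono mult_nonneg_nonneg) auto
      also have "b * b * b = 1 / ((j * L) * (sqrt j * sqrt L))"
        unfolding b0(2) by (simp add: b_def real_sqrt_mult)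
      also have "4 * (1 / ((j * L) * (sqrt j * sqrt L))) \<le> 4 * (1 / w)"
      proof (intro mult_left_mono divide_left_mono)
        have "w * 1 \<le> (j * sqrt j) * sqrt L * L"
          using w1 w0 L by (intro mult_mono) auto
        then show "w \<le> (j * L) * (sqrt j * sqrt L)" by (simp add: mult_ac)
        show "0 < (j * L) * (sqrt j * sqrt L) * w" using w0 j1 L by auto
      qed auto
      finally show ?thesis by simp
    qed
    have GG: "\<bar>\<integral>\<omega>. G \<omega> * z \<omega> \<partial>M\<bar> \<le> 4 / w \<and> \<bar>\<integral>\<omega>. G \<omega> * ((z \<omega>)\<^sup>2 - 1 / (j * L)) \<partial>M\<bar> \<le> 4 / w"
      if G: "G \<in> borel_measurable (past (Suc k))" "\<And>\<omega>. \<omega> \<in> space M \<Longrightarrow> \<bar>G \<omega>\<bar> \<le> 1" for G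
    proof
      have Gm: "G \<in> borel_measurable M" by (rule measurable_from_subalg[OF subalgebra_past G(1)])
      have GA: "AE \<omega> in M. \<bar>G \<omega>\<bar> \<le> 1" using G(2) by (intro AE_I2)
      have iGS: "integrable M (\<lambda>\<omega>. G \<omega> * S \<omega>)"
        using iS Sm by (intro integrable_bounded_mult[OF Gm GA]) (simp add: integrable_abs_iff)
      have iY: "integrable M Y"
        by (rule integrable_const_bound[where B = 1]) (use bdY Ym in auto)
      have iGY: "integrable M (\<lambda>\<omega>. G \<omega> * Y \<omega>)"
        by (intro integrable_bounded_mult[OF Gm GA] iY)
      have GY: "(\<integral>\<omega>. G \<omega> * Y \<omega> \<partial>M) = 1 / (2 * j) * (\<integral>\<omega>. G \<omega> * S \<omega> \<partial>M)"
        using expectation_mult_next_step[of "Suc k" G 1, OF _ G(1) GA] p j by (simp add: S_def Y_def)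
      have GS: "\<bar>\<integral>\<omega>. G \<omega> * S \<omega> \<partial>M\<bar> \<le> j"
      proof -
        have "\<bar>\<integral>\<omega>. G \<omega> * S \<omega> \<partial>M\<bar> \<le> (\<integral>\<omega>. \<bar>G \<omega> * S \<omega>\<bar> \<partial>M)" by (rule integral_abs_bound)
        also have "\<dots> \<le> (\<integral>\<omega>. j \<partial>M)"
        proof (rule integral_mono_AE)
          show "AE \<omega> in M. \<bar>G \<omega> * S \<omega>\<bar> \<le> j"
            using bdS GA
          proof eventually_elim
            case (elim \<omega>)
            then have "\<bar>G \<omega>\<bar> * \<bar>S \<omega>\<bar> \<le> 1 * j" by (intro mult_mono) auto
            then show ?case by (simp add: abs_mult)
          qed
        qed (use iGS in auto)
        finally show ?thesis using prob_space by simp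
      qed
      have "(\<integral>\<omega>. G \<omega> * z \<omega> \<partial>M) = (\<integral>\<omega>. a * (G \<omega> * Y \<omega>) + (a - b) * (G \<omega> * S \<omega>) \<partial>M)"
        unfolding z by (simp add: algebra_simps)
      also have "\<dots> = a * (\<integral>\<omega>. G \<omega> * Y \<omega> \<partial>M) + (a - b) * (\<integral>\<omega>. G \<omega> * S \<omega> \<partial>M)"
        using iGY iGS by simp
      also have "\<dots> = (a / (2 * j) + a - b) * (\<integral>\<omega>. G \<omega> * S \<omega> \<partial>M)"
        unfolding GY by (simp add: algebra_simps)
      finally have "\<bar>\<integral>\<omega>. G \<omega> * z \<omega> \<partial>M\<bar> = \<bar>a / (2 * j) + a - b\<bar> * \<bar>\<integral>\<omega>. G \<omega> * S \<omega> \<partial>M\<bar>"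
        by (simp only: abs_mult)
      also have "\<dots> \<le> b / (4 * j\<^sup>2) * j"
        using bab GS b0 by (intro mult_mono) auto
      also have "\<dots> = 1 / (4 * (j * (sqrt j * sqrt L)))"
        using j1 by (simp add: b_def real_sqrt_mult power2_eq_square)
      also have "\<dots> \<le> 1 / (w / 4)"
      proof (rule divide_left_mono)
        show "w / 4 \<le> 4 * (j * (sqrt j * sqrt L))"
          using w1 w0 by (simp add: mult_ac)
        show "0 < 4 * (j * (sqrt j * sqrt L)) * (w / 4)" using w0 j1 L by auto
      qed simp
      finally show "\<bar>\<integral>\<omega>. G \<omega> * z \<omega> \<partial>M\<bar> \<le> 4 / w" by simp
      have bb: "AE \<omega> in M. \<bar>G \<omega> * ((z \<omega>)\<^sup>2 - 1 / (j * L))\<bar> \<le> 1 / (j\<^sup>2 * L) + 5/4 * (1 / (j\<^sup>2 * L)) * \<bar>S \<omega>\<bar>"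
        using bdS bdY GA
      proof eventually_elim
        case (elim \<omega>)
        have Y2: "Y \<omega> * Y \<omega> = 1" using elim(2) by (metis abs_mult_self_eq mult_1)
        have "(z \<omega>)\<^sup>2 - 1 / (j * L) = (a * a - b * b) + 2 * (a * (a - b)) * (Y \<omega> * S \<omega>) + ((a - b) * S \<omega>) * ((a - b) * S \<omega>)"
          using Y2 unfolding z b0(2)[symmetric] power2_eq_square by (simp add: algebra_simps)
        then have "\<bar>(z \<omega>)\<^sup>2 - 1 / (j * L)\<bar> \<le> \<bar>a * a - b * b\<bar> + \<bar>2 * (a * (a - b)) * (Y \<omega> * S \<omega>)\<bar> + \<bar>((a - b) * S \<omega>) * ((a - b) * S \<omega>)\<bar>"
          by linarith
        also have "\<dots> \<le> 1 / (j\<^sup>2 * L) + (1 / (j\<^sup>2 * L)) * \<bar>S \<omega>\<bar> + 1/4 * (1 / (j\<^sup>2 * L)) * \<bar>S \<omega>\<bar>"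
        proof (intro add_mono)
          have "\<bar>a * a - b * b\<bar> = b * b - a * a" using mult_mono[OF aleb aleb] a0 b0 by auto
          also have "\<dots> = 1 / (j * (j + 1) * L)"
            unfolding a0(2) b0(2) using j1 L by (simp add: divide_simps)
          also have "\<dots> \<le> 1 / (j\<^sup>2 * L)"
            using j1 L by (intro divide_left_mono mult_right_mono) (auto simp: power2_eq_square)
          finally show "\<bar>a * a - b * b\<bar> \<le> 1 / (j\<^sup>2 * L)" .
          have aa: "a * a \<le> 1 / (j * L)" unfolding b0(2)[symmetric] using aleb a0 by (intro mult_mono) auto
          have "\<bar>2 * (a * (a - b)) * (Y \<omega> * S \<omega>)\<bar> = 2 * (a * (b - a)) * \<bar>S \<omega>\<bar>"
            using elim a0 aleb by (simp add: abs_mult)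
          also have "\<dots> \<le> 2 * (a * (a / (2 * j))) * \<bar>S \<omega>\<bar>"
            using ba a0 by (intro mult_right_mono mult_left_mono) auto
          also have "\<dots> = (a * a) / j * \<bar>S \<omega>\<bar>" by simp
          also have "\<dots> \<le> (1 / (j * L)) / j * \<bar>S \<omega>\<bar>"
            using aa j1 by (intro mult_right_mono divide_right_mono) auto
          finally show "\<bar>2 * (a * (a - b)) * (Y \<omega> * S \<omega>)\<bar> \<le> (1 / (j\<^sup>2 * L)) * \<bar>S \<omega>\<bar>"
            by (simp add: power2_eq_square mult_ac)
          have "\<bar>(a - b) * S \<omega>\<bar> = (b - a) * \<bar>S \<omega>\<bar>" using aleb by (simp add: abs_mult)
          \<comment> \<open>Of the two factors \<open>\<bar>S \<omega>\<bar>\<close> in the square,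
            one is kept and the other replaced by its bound \<open>j\<close>, so that the first
            moment suffices.\<close>
          moreover have "(b - a) * \<bar>S \<omega>\<bar> \<le> a / (2 * j) * \<bar>S \<omega>\<bar>" "(b - a) * \<bar>S \<omega>\<bar> \<le> a / (2 * j) * j"
            using elim aleb a0 j1 by (intro mult_mono ba; simp)+
          ultimately have "\<bar>(a - b) * S \<omega>\<bar> * \<bar>(a - b) * S \<omega>\<bar> \<le> (a / (2 * j) * \<bar>S \<omega>\<bar>) * (a / (2 * j) * j)"
            using a0 j1 by (intro mult_mono) auto
          also have "\<dots> = 1/4 * ((a * a) / j) * \<bar>S \<omega>\<bar>" using j1 by simp
          also have "\<dots> \<le> 1/4 * ((1 / (j * L)) / j) * \<bar>S \<omega>\<bar>"
            using aa j1 by (intro mult_right_mono mult_left_mono divide_right_mono) auto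
          finally show "\<bar>((a - b) * S \<omega>) * ((a - b) * S \<omega>)\<bar> \<le> 1/4 * (1 / (j\<^sup>2 * L)) * \<bar>S \<omega>\<bar>"
            by (simp add: power2_eq_square mult_ac abs_mult)
        qed
        finally have "\<bar>(z \<omega>)\<^sup>2 - 1 / (j * L)\<bar> \<le> 1 / (j\<^sup>2 * L) + 5/4 * (1 / (j\<^sup>2 * L)) * \<bar>S \<omega>\<bar>"
          by (simp add: algebra_simps)
        moreover have "\<bar>G \<omega>\<bar> * \<bar>(z \<omega>)\<^sup>2 - 1 / (j * L)\<bar> \<le> 1 * \<bar>(z \<omega>)\<^sup>2 - 1 / (j * L)\<bar>"
          using elim by (intro mult_right_mono) auto
        ultimately show ?case by (simp add: abs_mult)
      qed
      have iz2: "integrable M (\<lambda>\<omega>. (z \<omega>)\<^sup>2 - 1 / (j * L))"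
      proof (rule Bochner_Integration.integrable_diff)
        show "integrable M (\<lambda>\<omega>. (z \<omega>)\<^sup>2)"
        proof (rule integrable_const_bound[where B = "(3/2 * b)\<^sup>2"])
          show "AE \<omega> in M. norm ((z \<omega>)\<^sup>2) \<le> (3/2 * b)\<^sup>2"
            using bdz
          proof eventually_elim
            case (elim \<omega>)
            from power_mono[OF elim, of 2] show ?case by simp
          qed
        qed (use zm in auto)
      qed simp
      have "\<bar>\<integral>\<omega>. G \<omega> * ((z \<omega>)\<^sup>2 - 1 / (j * L)) \<partial>M\<bar> \<le> (\<integral>\<omega>. \<bar>G \<omega> * ((z \<omega>)\<^sup>2 - 1 / (j * L))\<bar> \<partial>M)"
        by (rule integral_abs_bound)
      also have "\<dots> \<le> (\<integral>\<omega>. 1 / (j\<^sup>2 * L) + 5/4 * (1 / (j\<^sup>2 * L)) * \<bar>S \<omega>\<bar> \<partial>M)"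
      proof (rule integral_mono_AE[OF _ _ bb])
        show "integrable M (\<lambda>\<omega>. \<bar>G \<omega> * ((z \<omega>)\<^sup>2 - 1 / (j * L))\<bar>)"
          by (intro integrable_abs integrable_bounded_mult[OF Gm GA] iz2)
        show "integrable M (\<lambda>\<omega>. 1 / (j\<^sup>2 * L) + 5/4 * (1 / (j\<^sup>2 * L)) * \<bar>S \<omega>\<bar>)"
          by (intro Bochner_Integration.integrable_add integrable_mult_right iS integrable_const)
      qed
      also have "\<dots> = 1 / (j\<^sup>2 * L) + 5/4 * (1 / (j\<^sup>2 * L)) * (\<integral>\<omega>. \<bar>S \<omega>\<bar> \<partial>M)"
        using iS prob_space by simp
      also have "\<dots> \<le> 1 / (j\<^sup>2 * L) + 5/4 * (1 / (j\<^sup>2 * L)) * (2 * j powr (3/4))"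
        using ES j1 L by (intro add_mono mult_left_mono) auto
      also have "\<dots> \<le> 1 / w + 5/2 * (1 / w)"
      proof (intro add_mono)
        show "1 / (j\<^sup>2 * L) \<le> 1 / w" using w2 w0 j1 L by (intro divide_left_mono) auto
        have "j powr (3/4) / (j\<^sup>2 * L) \<le> 1 / w"
          using w3 w0 j1 L by (subst frac_le_eq) (auto simp: divide_le_0_iff mult.commute)
        then have "5/2 * (j powr (3/4) / (j\<^sup>2 * L)) \<le> 5/2 * (1 / w)"
          by (intro mult_left_mono) auto
        also have "5/2 * (j powr (3/4) / (j\<^sup>2 * L)) = 5/4 * (1 / (j\<^sup>2 * L)) * (2 * j powr (3/4))"
          by simp
        finally show "5/4 * (1 / (j\<^sup>2 * L)) * (2 * j powr (3/4)) \<le> 5/2 * (1 / w)" .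
      qed
      also have "\<dots> \<le> 4 / w" using w0 by (simp add: field_simps)
      finally show "\<bar>\<integral>\<omega>. G \<omega> * ((z \<omega>)\<^sup>2 - 1 / (j * L)) \<partial>M\<bar> \<le> 4 / w" .
    qed
    have dpos: "0 \<le> 1 / (j * L)" "1 / (j * L) \<le> 1"
      using j1 L mult_mono[of 1 j 1 L] by auto
    show ?thesis
      unfolding w_def[symmetric] z_def[symmetric]
      using d2 i3 e3 GG dpos by blast
  qed
  show ?thesis
    unfolding near_brownian_def
  proof (intro conjI allI impI)
    fix k assume "k \<le> n"
    show "?Z k \<in> borel_measurable M" by measurable
  next
    fix k j assume "k < n" "j \<le> k"
    then show "?Z j \<in> borel_measurable (past (Suc k))" by (intro meas)
  qed (use step[OF refl] subalgebra_past in blast)+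
qed

end

section \<open>Laplace transform of the statistic for the critical walk\<close>

lemma harm_over_ln: "(\<lambda>n. harm n / ln (real n)) \<longlonglongrightarrow> 1"
proof -
  have "(\<lambda>n. 1 + (harm n - ln (real n)) * inverse (ln (real n))) \<longlonglongrightarrow> 1 + euler_mascheroni * 0"
    by (intro tendsto_intros euler_mascheroni_LIMSEQ tendsto_inverse_0_at_top
        filterlim_compose[OF ln_at_top filterlim_real_sequentially])
  then have "(\<lambda>n. 1 + (harm n - ln (real n)) * inverse (ln (real n))) \<longlonglongrightarrow> 1" by simp
  then show ?thesis
  proof (rule Lim_transform_eventually)
    show "\<forall>\<^sub>F n in sequentially. 1 + (harm n - ln (real n)) * inverse (ln (real n)) = harm n / ln (real n)"
      using eventually_gt_at_top[of 1]
      by eventually_elim (simp add: field_simps)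
  qed
qed

lemma one_le_ln: "3 \<le> x \<Longrightarrow> 1 \<le> ln (x :: real)"
  using exp_le by (subst ln_ge_iff) auto

context elephant_random_walk
begin

text \<open>The killing sum of the chain is V_n / (4 (log n)^2), so l^2 / 2 times it equals t V_n /
  (log n)^2 exactly when l^2 = 8 t. There are n - 1 steps because V_n stops at time n - 1, and the
  endpoint of the chain is the walk at time n.\<close>

lemma laplace_V_stat:
  assumes p: "p = 3/4" and t: "0 < t"
  shows "(\<lambda>n. \<integral>\<omega>. exp (- t * (V_stat X n \<omega> / (ln (real n))\<^sup>2)) \<partial>M) \<longlonglongrightarrow> exp (- kac_log (sqrt (8 * t)) 1)"
proof -
  define Z where "Z n k \<omega> = position X (Suc k) \<omega> / sqrt (real (Suc k) * ln (real n))" for n k \<omega>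
  define d where "d n k = 1 / (real (Suc k) * ln (real n))" for n k
  define err where "err n k = 4 / (real (Suc k) powr (5/4) * sqrt (ln (real n)))" for n k
  have inf: "filterlim (\<lambda>n. ln (real n)) at_top sequentially"
    by (rule filterlim_compose[OF ln_at_top filterlim_real_sequentially])
  have sinf: "filterlim (\<lambda>n. sqrt (ln (real n))) at_top sequentially"
    by (rule filterlim_compose[OF sqrt_at_top inf])
  have pred: "filterlim (\<lambda>n :: nat. n - 1) at_top sequentially"
    by (rule filterlim_minus_const_nat_at_top)
  have "eventually (\<lambda>n. harm n / ln (real n) < 2) sequentially"
    using harm_over_ln by (rule order_tendstoD) simp
  then obtain n1 where n1: "\<And>n. n1 \<le> n \<Longrightarrow> harm n / ln (real n) < 2"
    by (auto simp: eventually_sequentially)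
  \<comment> \<open>From here on log n is at least 1, as 3 exceeds Euler's number, and the second
    moment H_n / log n of the endpoint is below 2, a number chosen above its limit 1.\<close>
  define m0 where "m0 = max n1 3"
  have L: "1 \<le> ln (real n)" if "m0 \<le> n" for n
    using that by (intro one_le_ln) (auto simp: m0_def)
  have lim: "(\<lambda>n. \<integral>\<omega>. exp (- ((sqrt (8 * t))\<^sup>2 / 2 * (\<Sum>k<n - 1. d n k * (Z n k \<omega>)\<^sup>2))) \<partial>M)
      \<longlonglongrightarrow> exp (- kac_log (sqrt (8 * t)) 1)"
  proof (rule kac_limit[where F = "\<lambda>_ k. past (Suc k)" and err = err and K = 2
        and ?m0.0 = m0 and r = "\<lambda>n. 1 / sqrt (ln (real n))"])
    fix n assume n: "m0 \<le> n"
    then have n3: "3 \<le> n" by (simp add: m0_def)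
    show "near_brownian M (\<lambda>k. past (Suc k)) (Z n) (d n) (err n) (n - 1)"
      using near_brownian_position[OF p L[OF n]] unfolding Z_def d_def err_def .
    \<comment> \<open>The chain starts at time 1 of the walk, where the position is 1 or -1 rather
      than 0.\<close>
    show "AE \<omega> in M. \<bar>Z n 0 \<omega>\<bar> \<le> 1 / sqrt (ln (real n))"
      using abs_step[of 1] L[OF n] by (auto simp: Z_def position_def abs_mult)
    have Zn: "(Z n (n - 1) \<omega>)\<^sup>2 = (position X n \<omega>)\<^sup>2 / (real n * ln (real n))" for \<omega>
      using n3 L[OF n] by (simp add: Z_def power_divide)
    show "integrable M (\<lambda>\<omega>. (Z n (n - 1) \<omega>)\<^sup>2)"
      unfolding Zn using integrable_position_power[of n 2] by simp
    have "(\<integral>\<omega>. (Z n (n - 1) \<omega>)\<^sup>2 \<partial>M) = harm n / ln (real n)"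
      unfolding Zn using expectation_position_square[OF p, of n] n3 by simp
    then show "(\<integral>\<omega>. (Z n (n - 1) \<omega>)\<^sup>2 \<partial>M) \<le> 2"
      using n1[of n] n by (simp add: m0_def)
  next
    show "0 < sqrt (8 * t)" using t by simp
    have "summable (\<lambda>k. real (Suc k) powr (- 5/4))"
      using summable_real_powr_iff[of "- 5/4"] by (subst summable_Suc_iff) simp
    then have "(\<lambda>n. \<Sum>k<n. real (Suc k) powr (- 5/4)) \<longlonglongrightarrow> (\<Sum>k. real (Suc k) powr (- 5/4))"
      by (rule summable_LIMSEQ)
    from filterlim_compose[OF this pred]
    have "(\<lambda>n. 4 * inverse (sqrt (ln (real n))) * (\<Sum>k<n - 1. real (Suc k) powr (- 5/4)))
      \<longlonglongrightarrow> 4 * 0 * (\<Sum>k. real (Suc k) powr (- 5/4))"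
      by (intro tendsto_intros tendsto_inverse_0_at_top sinf)
    moreover have "(\<Sum>k<n - 1. err n k) = 4 * inverse (sqrt (ln (real n))) * (\<Sum>k<n - 1. real (Suc k) powr (- 5/4))" for n
      unfolding err_def sum_distrib_left by (intro sum.cong) (auto simp: powr_minus field_simps)
    ultimately show "(\<lambda>n. \<Sum>k<n - 1. err n k) \<longlonglongrightarrow> 0" by simp
    \<comment> \<open>The clock stops one step before n, hence the correction by 1 / (n log
      n).\<close>
    have "(\<lambda>n. harm n / ln (real n) - inverse (real n) * inverse (ln (real n))) \<longlonglongrightarrow> 1 - 0 * 0"
      by (intro tendsto_intros harm_over_ln tendsto_inverse_0_at_top inf filterlim_real_sequentially)
    then have "(\<lambda>n. harm n / ln (real n) - inverse (real n) * inverse (ln (real n))) \<longlonglongrightarrow> 1" by simp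
    then show "(\<lambda>n. \<Sum>k<n - 1. d n k) \<longlonglongrightarrow> 1"
    proof (rule Lim_transform_eventually)
      show "\<forall>\<^sub>F n in sequentially. harm n / ln (real n) - inverse (real n) * inverse (ln (real n)) = (\<Sum>k<n - 1. d n k)"
        using eventually_gt_at_top[of 1]
      proof eventually_elim
        case (elim n)
        then obtain m where m: "n = Suc m" by (cases n) auto
        have "(\<Sum>k<m. d n k) = (\<Sum>k<m. inverse (real (Suc k))) / ln (real n)"
          by (simp add: d_def sum_divide_distrib inverse_eq_divide)
        also have "(\<Sum>k<m. inverse (real (Suc k))) = harm m"
          by (simp add: harm_def sum.atLeast1_atMost_eq)
        finally have "(\<Sum>k<n - 1. d n k) = harm m / ln (real n)" by (simp add: m)
        also have "harm m = harm n - inverse (real n)" by (simp add: m harm_Suc)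
        finally show ?case by (simp add: left_diff_distrib divide_inverse)
      qed
    qed
    show "(\<lambda>n. 1 / sqrt (ln (real n))) \<longlonglongrightarrow> 0"
      using tendsto_inverse_0_at_top[OF sinf] by (simp add: inverse_eq_divide)
  qed
  have eq: "(sqrt (8 * t))\<^sup>2 / 2 * (\<Sum>k<n - 1. d n k * (Z n k \<omega>)\<^sup>2) = t * (V_stat X n \<omega> / (ln (real n))\<^sup>2)"
    if "m0 \<le> n" for n \<omega>
  proof -
    have "V_stat X n \<omega> = 4 * (\<Sum>k<n - 1. (position X (Suc k) \<omega> / real (Suc k))\<^sup>2)"
      unfolding V_stat_def
      by (intro arg_cong[of _ _ "\<lambda>x. 4 * x"] sum.reindex_bij_witness[of _ Suc "\<lambda>k. k - 1"]) auto
    moreover have "d n k * (Z n k \<omega>)\<^sup>2 = (position X (Suc k) \<omega> / real (Suc k))\<^sup>2 / (ln (real n))\<^sup>2" for k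
    proof -
      have "(Z n k \<omega>)\<^sup>2 = (position X (Suc k) \<omega>)\<^sup>2 / (real (Suc k) * ln (real n))"
        using L[OF that] by (simp add: Z_def power_divide)
      then show ?thesis by (simp add: d_def power2_eq_square)
    qed
    ultimately show ?thesis using t by (simp add: sum_divide_distrib[symmetric])
  qed
  show ?thesis
  proof (rule Lim_transform_eventually[OF lim])
    show "\<forall>\<^sub>F n in sequentially. (\<integral>\<omega>. exp (- ((sqrt (8 * t))\<^sup>2 / 2 * (\<Sum>k<n - 1. d n k * (Z n k \<omega>)\<^sup>2))) \<partial>M)
      = (\<integral>\<omega>. exp (- t * (V_stat X n \<omega> / (ln (real n))\<^sup>2)) \<partial>M)"
      using eventually_ge_at_top[of m0] by eventually_elim (simp only: eq mult_minus_left)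
  qed
qed

end

text \<open>Left endpoints, because the chain is killed at the rate of its position at the beginning
  of each step. Uniform continuity bounds the error on a cell by \<open>e / 2\<close> times its
  length, and induction on the number of cells adds these errors.\<close>

lemma riemann_sum_continuous:
  fixes f :: "real \<Rightarrow> real"
  assumes f: "continuous_on {0..1} f"
  shows "(\<lambda>m. \<Sum>k<m. 1 / real m * f (real k / real m)) \<longlonglongrightarrow> (LBINT t:{0..1}. f t)"
proof -
  have int: "f integrable_on {a..b}" if "0 \<le> a" "b \<le> 1" for a b
    using f that by (intro integrable_continuous_interval continuous_on_subset[OF f]) auto
  have "set_integrable lborel {0..1} f"
    by (rule borel_integrable_atLeastAtMost') (rule f)
  then have eq: "(LBINT t:{0..1}. f t) = integral {0..1} f"
    by (rule set_borel_integral_eq_integral(2))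
  have uc: "uniformly_continuous_on {0..1} f"
    by (rule compact_uniformly_continuous[OF f]) simp
  show ?thesis
  proof (rule LIMSEQ_I)
    fix e :: real assume e: "0 < e"
    then have "0 < e / 2" by simp
    then obtain \<delta> where \<delta>: "0 < \<delta>"
      "\<And>x y. x \<in> {0..1} \<Longrightarrow> y \<in> {0..1} \<Longrightarrow> dist y x < \<delta> \<Longrightarrow> dist (f y) (f x) < e / 2"
      using uc unfolding uniformly_continuous_on_def by metis
    obtain M where M: "0 < M" "inverse (real M) < \<delta>"
      using reals_Archimedean[OF \<delta>(1)] by (metis zero_less_Suc)
    show "\<exists>no. \<forall>m\<ge>no. norm ((\<Sum>k<m. 1 / real m * f (real k / real m)) - (LBINT t:{0..1}. f t)) < e"
    proof (intro exI[of _ M] allI impI)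
      fix m assume "M \<le> m"
      then have m: "0 < m" "1 / real m < \<delta>"
        using M le_imp_inverse_le[of "real M" "real m"] by (auto simp: inverse_eq_divide)
      have "\<bar>(\<Sum>k<j. 1 / real m * f (real k / real m)) - integral {0..real j / real m} f\<bar> \<le> real j * (e / 2 / real m)"
        if "j \<le> m" for j
        using that
      proof (induction j)
        case (Suc j)
        let ?a = "real j / real m" and ?b = "real (Suc j) / real m"
        have ab: "0 \<le> ?a" "?a \<le> ?b" "?b \<le> 1" "?b - ?a = 1 / real m"
          using Suc.prems m by (auto simp: field_simps)
        have split: "integral {0..?b} f = integral {0..?a} f + integral {?a..?b} f"
          using Henstock_Kurzweil_Integration.integral_combine[of 0 ?a ?b f] ab int[of 0 ?b] by simp
        have "integral {?a..?b} (\<lambda>t. f ?a - f t) = 1 / real m * f ?a - integral {?a..?b} f"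
          using ab int[of ?a ?b] by (subst Henstock_Kurzweil_Integration.integral_diff) auto
        moreover have "norm (integral {?a..?b} (\<lambda>t. f ?a - f t)) \<le> e / 2 * (?b - ?a)"
        proof (rule integral_bound[OF ab(2)])
          show "continuous_on {?a..?b} (\<lambda>t. f ?a - f t)"
            using ab by (intro continuous_intros continuous_on_subset[OF f]) auto
          fix t assume t: "t \<in> {?a..?b}"
          then have "dist ?a t < \<delta>" using ab m by (auto simp: dist_real_def)
          moreover have "t \<in> {0..1}" "?a \<in> {0..1}"
            unfolding atLeastAtMost_iff using ab t by (meson atLeastAtMost_iff order_trans)+
          ultimately have "dist (f ?a) (f t) < e / 2" by (intro \<delta>(2))
          then show "norm (f ?a - f t) \<le> e / 2" by (simp add: dist_real_def)
        qed
        ultimately have "\<bar>1 / real m * f ?a - integral {?a..?b} f\<bar> \<le> e / 2 / real m"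
          unfolding ab(4) by simp
        moreover have "real (Suc j) * (e / 2 / real m) = real j * (e / 2 / real m) + e / 2 / real m"
          by (simp add: algebra_simps add_divide_distrib)
        ultimately show ?case using Suc.IH Suc.prems unfolding split by simp
      qed simp
      from this[of m] have "\<bar>(\<Sum>k<m. 1 / real m * f (real k / real m)) - integral {0..1} f\<bar> \<le> e / 2"
        using m by simp
      then show "norm ((\<Sum>k<m. 1 / real m * f (real k / real m)) - (LBINT t:{0..1}. f t)) < e"
        using e by (simp add: eq)
    qed
  qed
qed

subsection \<open>Brownian motion\<close>

context standard_brownian_motion
begin

lemma increment_moments:
  assumes "0 \<le> s" "s < t"
  shows "integrable N (\<lambda>\<omega>. B t \<omega> - B s \<omega>)" "(\<integral>\<omega>. B t \<omega> - B s \<omega> \<partial>N) = 0"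
    "integrable N (\<lambda>\<omega>. (B t \<omega> - B s \<omega>)\<^sup>2)" "(\<integral>\<omega>. (B t \<omega> - B s \<omega>)\<^sup>2 \<partial>N) = t - s"
    "integrable N (\<lambda>\<omega>. \<bar>B t \<omega> - B s \<omega>\<bar> ^ 3)" "(\<integral>\<omega>. \<bar>B t \<omega> - B s \<omega>\<bar> ^ 3 \<partial>N) \<le> 2 * sqrt (t - s) ^ 3"
proof -
  define \<sigma> where "\<sigma> = sqrt (t - s)"
  have \<sigma>: "0 < \<sigma>" "\<sigma>\<^sup>2 = t - s" using assms by (auto simp: \<sigma>_def)
  have D: "distributed N lborel (\<lambda>\<omega>. B t \<omega> - B s \<omega>) (\<lambda>x. ennreal (normal_density 0 \<sigma> x))"
    unfolding \<sigma>_def by (rule gaussian_increments[OF assms])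
  have moment: "integrable N (\<lambda>\<omega>. g (B t \<omega> - B s \<omega>)) \<and> (\<integral>\<omega>. g (B t \<omega> - B s \<omega>) \<partial>N) = c"
    if "has_bochner_integral lborel (\<lambda>x. normal_density 0 \<sigma> x * g x) c" "g \<in> borel_measurable borel" for g c
    using distributed_integrable[OF D, of g] distributed_integral[OF D, of g] that
    by (auto simp: has_bochner_integral_iff)
  show "integrable N (\<lambda>\<omega>. B t \<omega> - B s \<omega>)" "(\<integral>\<omega>. B t \<omega> - B s \<omega> \<partial>N) = 0"
    using moment[of "\<lambda>x. x" 0] normal_moment_odd[OF \<sigma>(1), of 0 0] by auto
  show "integrable N (\<lambda>\<omega>. (B t \<omega> - B s \<omega>)\<^sup>2)" "(\<integral>\<omega>. (B t \<omega> - B s \<omega>)\<^sup>2 \<partial>N) = t - s"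
    using moment[of "\<lambda>x. x\<^sup>2" "\<sigma>\<^sup>2"] normal_moment_even[OF \<sigma>(1), of 0 1] unfolding \<sigma>(2)[symmetric] by auto
  have m3: "integrable N (\<lambda>\<omega>. \<bar>B t \<omega> - B s \<omega>\<bar> ^ 3)"
    "(\<integral>\<omega>. \<bar>B t \<omega> - B s \<omega>\<bar> ^ 3 \<partial>N) = 2 * \<sigma> ^ 3 * sqrt (2 / pi)"
    using moment[of "\<lambda>x. \<bar>x\<bar> ^ 3" "2 * \<sigma> ^ 3 * sqrt (2 / pi)"] normal_moment_abs_odd[OF \<sigma>(1), of 0 1]
    by (auto simp: numeral_3_eq_3)
  show "integrable N (\<lambda>\<omega>. \<bar>B t \<omega> - B s \<omega>\<bar> ^ 3)" by (rule m3)
  have "sqrt (2 / pi) \<le> 1" using pi_ge_two by simp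
  then have "2 * \<sigma> ^ 3 * sqrt (2 / pi) \<le> 2 * \<sigma> ^ 3 * 1" using \<sigma> by (intro mult_left_mono) auto
  then show "(\<integral>\<omega>. \<bar>B t \<omega> - B s \<omega>\<bar> ^ 3 \<partial>N) \<le> 2 * sqrt (t - s) ^ 3"
    unfolding m3(2) by (simp add: \<sigma>_def)
qed

text \<open>Drift and variance errors vanish by independence; the error bound comes from the third
  absolute moment, of order m^(-3/2), and from d^2. The filtration is generated by the grid
  increments, to which \<open>independent_increments\<close> applies directly; it contains the grid
  values, since these are sums of increments starting from 0.\<close>

lemma near_brownian_motion:
  assumes m: "1 \<le> m"
  shows "\<exists>F. near_brownian N F (\<lambda>k. B (real k / real m)) (\<lambda>_. 1 / real m) (\<lambda>_. 2 / (real m * sqrt (real m))) m"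
proof -
  define \<xi> where "\<xi> k \<omega> = B (real (Suc k) / real m) \<omega> - B (real k / real m) \<omega>" for k \<omega>
  define E where "E k = {\<xi> k -` A \<inter> space N | A. A \<in> sets borel}" for k
  define F where "F k = sigma (space N) (\<Union>j\<in>{..<k}. E j)" for k
  have Bm: "B (real k / real m) \<in> borel_measurable N" for k
    by (rule value_measurable) simp
  have \<xi>m: "\<xi> k \<in> borel_measurable N" for k
    unfolding \<xi>_def[abs_def] by (intro borel_measurable_diff Bm)
  have spF: "space (F k) = space N" for k
    by (simp add: F_def space_measure_of_conv)
  have sF: "sets (F k) = sigma_sets (space N) (\<Union>j\<in>{..<k}. E j)" for k
    unfolding F_def by (rule sets_measure_of) (auto simp: E_def)
  have sub: "subalgebra N (F k)" for k
  proof -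
    have "sigma_sets (space N) (\<Union>j\<in>{..<k}. E j) \<subseteq> sets N"
      by (rule sets.sigma_sets_subset) (use measurable_sets[OF \<xi>m] in \<open>auto simp: E_def\<close>)
    then show ?thesis by (simp add: subalgebra_def spF sF)
  qed
  have \<xi>F: "\<xi> j \<in> borel_measurable (F k)" if "j < k" for j k
  proof (rule measurableI)
    fix A :: "real set" assume "A \<in> sets borel"
    then show "\<xi> j -` A \<inter> space (F k) \<in> sets (F k)"
      unfolding sF spF using that by (intro sigma_sets.Basic) (auto simp: E_def)
  qed simp
  have BF: "B (real j / real m) \<in> borel_measurable (F k)" if "j \<le> k" for j k
  proof -
    have "B (real j / real m) \<omega> = (\<Sum>i<j. \<xi> i \<omega>)" if "\<omega> \<in> space (F k)" for \<omega>
      using starts_at_zero[of \<omega>] that unfolding spF \<xi>_def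
      by (subst sum_lessThan_telescope) simp
    moreover have "(\<lambda>\<omega>. \<Sum>i<j. \<xi> i \<omega>) \<in> borel_measurable (F k)"
      using \<xi>F that by (intro borel_measurable_sum) auto
    ultimately show ?thesis by (subst measurable_cong) auto
  qed
  have indep: "indep_set (sets (F k)) {\<xi> k -` A \<inter> space N | A. A \<in> sets borel}" for k
  proof -
    have "indep_vars (\<lambda>_. borel) \<xi> {..<Suc k}"
      unfolding \<xi>_def[abs_def]
      by (rule independent_increments[of "\<lambda>k. real k / real m"]) (use m in \<open>auto simp: divide_right_mono\<close>)
    then have "indep_sets E {..<Suc k}"
      unfolding indep_vars_def2 E_def by blast
    \<comment> \<open>Grouping the indices into the blocks \<open>{..<k}\<close> and
      \<open>{k}\<close> turns independence of single increments into independence of the past from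
      the next increment.\<close>
    moreover have "{..<Suc k} = (\<Union>b\<in>UNIV. case_bool {..<k} {k} b)"
      by (auto simp: UNIV_bool)
    ultimately have "indep_sets (\<lambda>b. sigma_sets (space N) (\<Union>i\<in>case_bool {..<k} {k} b. E i)) UNIV"
    proof (intro indep_sets_collect_sigma)
      show "Int_stable (E i)" for i
      proof (rule Int_stableI)
        fix a b assume "a \<in> E i" "b \<in> E i"
        then obtain A B where "A \<in> sets borel" "B \<in> sets borel" "a = \<xi> i -` A \<inter> space N" "b = \<xi> i -` B \<inter> space N"
          by (auto simp: E_def)
        then show "a \<inter> b \<in> E i" unfolding E_def by (intro CollectI exI[of _ "A \<inter> B"]) auto
      qed
      show "disjoint_family_on (case_bool {..<k} {k}) UNIV"
        by (auto simp: disjoint_family_on_def split: bool.split)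
    qed simp
    then show ?thesis
      unfolding indep_set_def
    proof (rule indep_sets_mono_sets)
      fix b :: bool
      show "case_bool (sets (F k)) {\<xi> k -` A \<inter> space N | A. A \<in> sets borel} b
        \<subseteq> sigma_sets (space N) (\<Union>i\<in>case_bool {..<k} {k} b. E i)"
        by (cases b) (auto simp: sF E_def)
    qed
  qed
  have mono: "real k / real m < real (Suc k) / real m" "real (Suc k) / real m - real k / real m = 1 / real m" for k
    using m by (auto simp: field_simps)
  note mom = increment_moments[OF _ mono(1), unfolded mono(2), folded \<xi>_def, simplified]
  define e where "e = 2 / (real m * sqrt (real m))"
  have e: "0 \<le> e" "(1 / real m)\<^sup>2 \<le> e" "2 * sqrt (1 / real m) ^ 3 \<le> e"
  proof -
    show "0 \<le> e" by (simp add: e_def)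
    have "sqrt (real m) \<le> real m" using m by (simp add: real_le_lsqrt self_le_power)
    then have "sqrt (real m) \<le> 2 * real m" by simp
    then show "(1 / real m)\<^sup>2 \<le> e" using m by (simp add: e_def power2_eq_square field_simps)
    show "2 * sqrt (1 / real m) ^ 3 \<le> e"
      using m by (simp add: e_def power3_eq_cube real_sqrt_divide)
  qed
  have G: "\<bar>\<integral>\<omega>. G \<omega> * \<xi> k \<omega> \<partial>N\<bar> \<le> e \<and> \<bar>\<integral>\<omega>. G \<omega> * ((\<xi> k \<omega>)\<^sup>2 - 1 / real m) \<partial>N\<bar> \<le> e"
    if "G \<in> borel_measurable (F k)" "\<forall>\<omega>\<in>space N. \<bar>G \<omega>\<bar> \<le> 1" for G k
  proof -
    have Gi: "integrable N G"
      by (rule integrable_const_bound[where B = 1])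
        (use that measurable_from_subalg[OF sub that(1)] in \<open>auto intro: AE_I2\<close>)
    have "(\<integral>\<omega>. G \<omega> * \<xi> k \<omega> \<partial>N) = 0"
      using expectation_indep_mult[OF sub that(1) Gi \<xi>m indep, of "\<lambda>x. x"] mom(1,2)[of k] by simp
    moreover have "(\<integral>\<omega>. G \<omega> * ((\<xi> k \<omega>)\<^sup>2 - 1 / real m) \<partial>N) = 0"
      using expectation_indep_mult[OF sub that(1) Gi \<xi>m indep, of "\<lambda>x. x\<^sup>2 - 1 / real m"] mom(3,4)[of k] prob_space
      by simp
    ultimately show ?thesis using e by simp
  qed
  have cube: "integrable N (\<lambda>\<omega>. \<bar>\<xi> k \<omega>\<bar> ^ 3)" "(\<integral>\<omega>. \<bar>\<xi> k \<omega>\<bar> ^ 3 \<partial>N) \<le> e" for k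
    using mom(5,6)[of k] e by auto
  have "0 \<le> 1 / real m" "1 / real m \<le> 1" using m by auto
  then have "near_brownian N F (\<lambda>k. B (real k / real m)) (\<lambda>_. 1 / real m) (\<lambda>_. e) m"
    unfolding near_brownian_def \<xi>_def[symmetric] using Bm sub BF cube G e(2) by blast
  then show ?thesis unfolding e_def by blast
qed

text \<open>The Laplace transforms of the Riemann sums have two limits: one by
  \<open>kac_limit\<close> along the grid, with \<open>K = 1\<close> from E B_1^2 = 1, the other by
  convergence on every path and domination by 1. Their equality is the Cameron-Martin formula, with
  value cosh(l)^(-1/2).\<close>

lemma laplace_square_integral:
  assumes l: "0 < l"
  shows "(\<integral>\<omega>. exp (- (l\<^sup>2 / 2 * (LBINT t:{0..1}. (B t \<omega>)\<^sup>2))) \<partial>N) = exp (- kac_log l 1)"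
    and "(\<lambda>\<omega>. LBINT t:{0..1}. (B t \<omega>)\<^sup>2) \<in> borel_measurable N"
proof -
  define A where "A m \<omega> = (\<Sum>k<m. 1 / real m * (B (real k / real m) \<omega>)\<^sup>2)" for m \<omega>
  have Am [measurable]: "A m \<in> borel_measurable N" for m
    unfolding A_def[abs_def]
    by (intro borel_measurable_sum borel_measurable_times borel_measurable_power value_measurable) auto
  have A: "(\<lambda>m. A m \<omega>) \<longlonglongrightarrow> (LBINT t:{0..1}. (B t \<omega>)\<^sup>2)" if "\<omega> \<in> space N" for \<omega>
    unfolding A_def
    by (rule riemann_sum_continuous)
      (intro continuous_intros continuous_on_subset[OF continuous_paths[OF that]], auto)
  show meas: "(\<lambda>\<omega>. LBINT t:{0..1}. (B t \<omega>)\<^sup>2) \<in> borel_measurable N"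
    by (rule borel_measurable_LIMSEQ_real[OF A Am])
  obtain F where F: "\<And>m. 1 \<le> m \<Longrightarrow> near_brownian N (F m) (\<lambda>k. B (real k / real m)) (\<lambda>_. 1 / real m) (\<lambda>_. 2 / (real m * sqrt (real m))) m"
    using near_brownian_motion by metis
  have 1: "(\<lambda>m. \<integral>\<omega>. exp (- (l\<^sup>2 / 2 * A m \<omega>)) \<partial>N) \<longlonglongrightarrow> exp (- kac_log l 1)"
    unfolding A_def
  proof (rule kac_limit[where F = F and ?m0.0 = 1 and r = "\<lambda>_. 0" and K = 1, OF F l])
    have "(\<lambda>m. 2 * inverse (sqrt (real m))) \<longlonglongrightarrow> 2 * 0"
      by (intro tendsto_intros tendsto_inverse_0_at_top filterlim_compose[OF sqrt_at_top filterlim_real_sequentially])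
    moreover have "(\<Sum>k<m. 2 / (real m * sqrt (real m))) = 2 * inverse (sqrt (real m))" for m
      by (cases "m = 0") (auto simp: field_simps)
    ultimately show "(\<lambda>m. \<Sum>k<m. 2 / (real m * sqrt (real m))) \<longlonglongrightarrow> 0" by simp
    show "(\<lambda>m. \<Sum>k<m. 1 / real m) \<longlonglongrightarrow> 1"
      by (rule Lim_transform_eventually[OF tendsto_const])
        (use eventually_gt_at_top[of 0] in \<open>eventually_elim, simp\<close>)
    fix m :: nat assume m: "1 \<le> m"
    show "AE \<omega> in N. \<bar>B (real 0 / real m) \<omega>\<bar> \<le> 0" using starts_at_zero by (intro AE_I2) simp
    have eq: "(B (real m / real m) \<omega>)\<^sup>2 = (B 1 \<omega> - B 0 \<omega>)\<^sup>2" if "\<omega> \<in> space N" for \<omega>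
      using m starts_at_zero[OF that] by simp
    show "integrable N (\<lambda>\<omega>. (B (real m / real m) \<omega>)\<^sup>2)"
      using increment_moments(3)[of 0 1] eq by (simp cong: Bochner_Integration.integrable_cong)
    show "(\<integral>\<omega>. (B (real m / real m) \<omega>)\<^sup>2 \<partial>N) \<le> 1"
      using increment_moments(4)[of 0 1] eq by (simp cong: Bochner_Integration.integral_cong)
  qed simp_all
  have "(\<lambda>m. \<integral>\<omega>. exp (- (l\<^sup>2 / 2 * A m \<omega>)) \<partial>N) \<longlonglongrightarrow> (\<integral>\<omega>. exp (- (l\<^sup>2 / 2 * (LBINT t:{0..1}. (B t \<omega>)\<^sup>2))) \<partial>N)"
  proof (rule integral_dominated_convergence[where w = "\<lambda>_. 1"])
    show "AE \<omega> in N. (\<lambda>m. exp (- (l\<^sup>2 / 2 * A m \<omega>))) \<longlonglongrightarrow> exp (- (l\<^sup>2 / 2 * (LBINT t:{0..1}. (B t \<omega>)\<^sup>2)))"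
      by (rule AE_I2) (intro tendsto_intros A)
    show "AE \<omega> in N. norm (exp (- (l\<^sup>2 / 2 * A m \<omega>))) \<le> 1" for m
      by (rule AE_I2) (auto simp: A_def intro!: mult_nonneg_nonneg sum_nonneg)
  qed (use meas in auto)
  with 1 show "(\<integral>\<omega>. exp (- (l\<^sup>2 / 2 * (LBINT t:{0..1}. (B t \<omega>)\<^sup>2))) \<partial>N) = exp (- kac_log l 1)"
    by (rule LIMSEQ_unique[OF _ _, symmetric])
qed

end

section \<open>Growth along a single superdiffusive path\<close>

text \<open>From some index on, s_k^2 is at least (l^2 / 2) k^(2r), so each term is at least a
  multiple of k^(2r - 2). As r \<le> 1, this power is non-increasing and may be replaced by its
  value at n; about n equal terms then give the order n^(2r - 1), which beats (log n)^2 because r >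
  1/2.\<close>

lemma power_sum_over_ln_square_at_top:
  fixes s :: "nat \<Rightarrow> real"
  assumes r: "1/2 < r" "r \<le> 1" and s: "(\<lambda>n. s n / real n powr r) \<longlonglongrightarrow> l" and l: "l \<noteq> 0"
  shows "filterlim (\<lambda>n. 4 * (\<Sum>k=1..<n. (s k / real k)\<^sup>2) / (ln (real n))\<^sup>2) at_top sequentially"
proof -
  define c where "c = l\<^sup>2 / 2"
  have c: "0 < c" using l by (simp add: c_def)
  have "(\<lambda>n. (s n / real n powr r)\<^sup>2) \<longlonglongrightarrow> l\<^sup>2" by (intro tendsto_intros s)
  then have "eventually (\<lambda>n. c < (s n / real n powr r)\<^sup>2) sequentially"
    by (rule order_tendstoD) (use l in \<open>simp add: c_def\<close>)
  then obtain K where K: "\<And>n. K \<le> n \<Longrightarrow> c < (s n / real n powr r)\<^sup>2"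
    by (auto simp: eventually_sequentially)
  define K' where "K' = max 1 K"
  have lower: "4 * c * ((real n - real K') * real n powr (2 * r - 2) / (ln (real n))\<^sup>2)
      \<le> 4 * (\<Sum>k=1..<n. (s k / real k)\<^sup>2) / (ln (real n))\<^sup>2" if n: "K' \<le> n" for n
  proof -
    have term_le: "c * real n powr (2 * r - 2) \<le> (s k / real k)\<^sup>2" if k: "k \<in> {K'..<n}" for k
    proof -
      have k1: "1 \<le> real k" "K \<le> k" using k by (auto simp: K'_def)
      have kr: "(real k powr r)\<^sup>2 = real k powr (2 * r)"
        using k1 by (simp add: powr_numeral[symmetric] powr_powr mult.commute)
      have "c * real n powr (2 * r - 2) \<le> c * real k powr (2 * r - 2)"
        using c r k k1 by (intro mult_left_mono powr_mono2') auto
      also have "real k powr (2 * r - 2) = (real k powr r)\<^sup>2 / (real k)\<^sup>2"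
        unfolding kr using k1 by (simp add: powr_diff powr_numeral)
      also have "c * ((real k powr r)\<^sup>2 / (real k)\<^sup>2) \<le> (s k / real k powr r)\<^sup>2 * ((real k powr r)\<^sup>2 / (real k)\<^sup>2)"
        using K[OF k1(2)] by (intro mult_right_mono) auto
      also have "\<dots> = (s k / real k)\<^sup>2"
        using k1 by (simp add: power_divide)
      finally show ?thesis .
    qed
    have "(real n - real K') * (c * real n powr (2 * r - 2)) = (\<Sum>k=K'..<n. c * real n powr (2 * r - 2))"
      using n by (simp add: of_nat_diff)
    also have "\<dots> \<le> (\<Sum>k=K'..<n. (s k / real k)\<^sup>2)" by (intro sum_mono term_le)
    also have "\<dots> \<le> (\<Sum>k=1..<n. (s k / real k)\<^sup>2)"
      by (intro sum_mono2) (auto simp: K'_def)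
    finally have "4 * ((real n - real K') * (c * real n powr (2 * r - 2))) / (ln (real n))\<^sup>2
        \<le> 4 * (\<Sum>k=1..<n. (s k / real k)\<^sup>2) / (ln (real n))\<^sup>2"
      by (intro divide_right_mono) auto
    then show ?thesis by (simp add: mult_ac)
  qed
  have "filterlim (\<lambda>n. (real n - real K') * real n powr (2 * r - 2) / (ln (real n))\<^sup>2) at_top sequentially"
    using r by real_asymp
  then have "filterlim (\<lambda>n. 4 * c * ((real n - real K') * real n powr (2 * r - 2) / (ln (real n))\<^sup>2)) at_top sequentially"
    using c by (intro filterlim_tendsto_pos_mult_at_top[OF tendsto_const]) auto
  then show ?thesis
    by (rule filterlim_at_top_mono) (intro eventually_sequentiallyI[of K'] lower)
qed

section \<open>Conclusion in both regimes\<close>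

lemma weak_conv_V_stat:
  assumes erw: "elephant_random_walk M p q X" and p: "p = 3/4" and bm: "standard_brownian_motion N B"
  shows "weak_conv_m (\<lambda>n. distr M borel (\<lambda>\<omega>. V_stat X n \<omega> / (ln (real n))\<^sup>2))
    (distr N borel (\<lambda>\<omega>. 4 * (LBINT t:{0..1}. (B t \<omega>)\<^sup>2)))"
proof -
  interpret erw: elephant_random_walk M p q X by fact
  interpret bm: standard_brownian_motion N B by fact
  have Vm: "(\<lambda>\<omega>. V_stat X n \<omega> / (ln (real n))\<^sup>2) \<in> borel_measurable M" for n
    unfolding V_stat_def by measurable
  have Im: "(\<lambda>\<omega>. LBINT t:{0..1}. (B t \<omega>)\<^sup>2) \<in> borel_measurable N"
    by (rule bm.laplace_square_integral(2)) (rule zero_less_one)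
  then have Im4: "(\<lambda>\<omega>. 4 * (LBINT t:{0..1}. (B t \<omega>)\<^sup>2)) \<in> borel_measurable N"
    by measurable
  have e: "(\<lambda>v. exp (- t * v)) \<in> borel_measurable borel" for t :: real by measurable
  show ?thesis
  proof (rule laplace_conv_imp_weak_conv)
    have "0 \<le> V_stat X n \<omega> / (ln (real n))\<^sup>2" for n \<omega>
      unfolding V_stat_def by (intro divide_nonneg_nonneg mult_nonneg_nonneg sum_nonneg) auto
    then show "AE v in distr M borel (\<lambda>\<omega>. V_stat X n \<omega> / (ln (real n))\<^sup>2). 0 \<le> v" for n
      by (subst AE_distr_iff[OF Vm]) auto
    have "0 \<le> 4 * (LBINT t:{0..1}. (B t \<omega>)\<^sup>2)" for \<omega>
      unfolding set_lebesgue_integral_def by (intro mult_nonneg_nonneg Bochner_Integration.integral_nonneg) auto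
    then show "AE v in distr N borel (\<lambda>\<omega>. 4 * (LBINT t:{0..1}. (B t \<omega>)\<^sup>2)). 0 \<le> v"
      by (subst AE_distr_iff[OF Im4]) auto
    fix t :: real assume t: "0 < t"
    have "(\<integral>v. exp (- t * v) \<partial>distr N borel (\<lambda>\<omega>. 4 * (LBINT t:{0..1}. (B t \<omega>)\<^sup>2)))
      = (\<integral>\<omega>. exp (- ((sqrt (8 * t))\<^sup>2 / 2 * (LBINT t:{0..1}. (B t \<omega>)\<^sup>2))) \<partial>N)"
      \<comment> \<open>The limit is four times the integral, and 4 t = l^2 / 2 for the same l =
        sqrt (8 t) as in the walk.\<close>
      using t by (subst integral_distr[OF Im4 e]) (simp add: mult_ac)
    also have "\<dots> = exp (- kac_log (sqrt (8 * t)) 1)"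
      using t by (intro bm.laplace_square_integral(1)) simp
    finally show "(\<lambda>n. \<integral>v. exp (- t * v) \<partial>distr M borel (\<lambda>\<omega>. V_stat X n \<omega> / (ln (real n))\<^sup>2))
      \<longlonglongrightarrow> (\<integral>v. exp (- t * v) \<partial>distr N borel (\<lambda>\<omega>. 4 * (LBINT t:{0..1}. (B t \<omega>)\<^sup>2)))"
      using erw.laplace_V_stat[OF p t] by (simp only: integral_distr[OF Vm e])
  qed (intro erw.real_distribution_distr bm.real_distribution_distr Vm Im4)+
qed

theorem theorem3p15:
  fixes M :: "'a measure" and p q :: real and X :: "nat \<Rightarrow> 'a \<Rightarrow> real"
    and N :: "'b measure" and B :: "real \<Rightarrow> 'b \<Rightarrow> real"
    and L :: "'a \<Rightarrow> real"
  assumes "elephant_random_walk M p q X"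
  shows "(p = 3/4 \<longrightarrow> standard_brownian_motion N B \<longrightarrow>
            weak_conv_m
              (\<lambda>n. distr M borel (\<lambda>\<omega>. V_stat X n \<omega> / (ln (real n))\<^sup>2))
              (distr N borel (\<lambda>\<omega>. 4 * (LBINT t:{0..1}. (B t \<omega>)\<^sup>2))))
       \<and> (p > 3/4 \<longrightarrow> L \<in> borel_measurable M \<longrightarrow>
            (AE \<omega> in M. (\<lambda>n. position X n \<omega> / real n powr (2 * p - 1)) \<longlonglongrightarrow> L \<omega>) \<longrightarrow>
            (AE \<omega> in uniform_measure M {\<omega> \<in> space M. (L \<omega>)\<^sup>2 > 0}.
               filterlim (\<lambda>n. V_stat X n \<omega> / (ln (real n))\<^sup>2) at_top sequentially))"
proof (intro conjI impI)
  assume "p = 3/4" "standard_brownian_motion N B"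
  then show "weak_conv_m
              (\<lambda>n. distr M borel (\<lambda>\<omega>. V_stat X n \<omega> / (ln (real n))\<^sup>2))
              (distr N borel (\<lambda>\<omega>. 4 * (LBINT t:{0..1}. (B t \<omega>)\<^sup>2)))"
    by (rule weak_conv_V_stat[OF assms])
next
  assume p: "p > 3/4" and L [measurable]: "L \<in> borel_measurable M"
    and lim: "AE \<omega> in M. (\<lambda>n. position X n \<omega> / real n powr (2 * p - 1)) \<longlonglongrightarrow> L \<omega>"
  interpret elephant_random_walk M p q X by fact
  show "AE \<omega> in uniform_measure M {\<omega> \<in> space M. (L \<omega>)\<^sup>2 > 0}.
               filterlim (\<lambda>n. V_stat X n \<omega> / (ln (real n))\<^sup>2) at_top sequentially"
  \<comment> \<open>Conditioning only restricts attention to paths in the event, so the claim is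
    proved path by path: wherever the limit exists and is nonzero, the deterministic growth lemma
    applies with exponent 2p - 1, which lies in (1/2, 1].\<close>
  proof (rule AE_uniform_measureI)
    show "{\<omega> \<in> space M. (L \<omega>)\<^sup>2 > 0} \<in> sets M" by measurable
    show "AE \<omega> in M. \<omega> \<in> {\<omega> \<in> space M. (L \<omega>)\<^sup>2 > 0} \<longrightarrow>
        filterlim (\<lambda>n. V_stat X n \<omega> / (ln (real n))\<^sup>2) at_top sequentially"
      using lim
    proof eventually_elim
      case (elim \<omega>)
      then show ?case
        using power_sum_over_ln_square_at_top[of "2 * p - 1" "\<lambda>n. position X n \<omega>" "L \<omega>"] p p_range
        unfolding V_stat_def by auto
    qed
  qed
qed

end
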